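(* Let $\omega=(-1+i\sqrt3)/2$, and let $$\mathcal P_\omega=\{S_{\alpha,\beta}:\alpha,\beta\in\mathbb Z[\omega],\ \alpha,\beta\text{ relatively prime in }\mathbb Z[\omega]\},$$ $$\mathcal B_\omega=\{\langle a,b,c\rangle: a,b,c,d\in\mathbb Z,\ \gcd(a,b,c,d)=1,\ (a+b+c+d)^2=a^2+b^2+c^2+d^2,\ a+b+c>0\},$$ and let $\mathcal G_\omega$ be the set of spheres generated from $\{S_{0,1},S_{1,1},S_{1+\omega,1}\}$ by the tetrahedral procedure described in the context. Then $$\mathcal B_\omega=\mathcal P_\omega=\mathcal G_\omega.$$
   Context: Identify $\mathbb R^3$ with $\mathbb C\times\mathbb R$. For $z\in\mathbb C$ and $r>0$, $S(z,r)$ is the sphere with center $(z,r)$ and radius $r$, tangent to $\mathbb C$ at $z$; such spheres are called normal. For $\alpha,\beta\in\mathbb C$, $S_{\alpha,\beta}:=S\left(\frac\alpha\beta,\frac1{2|\beta|^2}\right)$, where $S_{1,0}$ is interpreted as the plane parallel to, and one unit above, $\mathbb C$. For real $a,b,c$ with $a+b+c>0$, $$\langle a,b,c\rangle:=S\left(\frac{b+c(1+\omega)}{a+b+c},\frac1{2(a+b+c)}\right).$$ $\mathbb Z[\omega]=\{a+b\omega:a,b\in\mathbb Z\}$ is the ring of Eisenstein integers; $\alpha,\beta\in\mathbb Z[\omega]$ are relatively prime if the only Eisenstein integers dividing both are units. Tetrahedral procedure: given any three mutually tangent normal spheres, there are exactly two normal spheres each of which, together with the original three, forms four mutually tangent spheres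 (with the understanding that planes parallel to the complex plane are spheres tangent at $\infty$). Start with $\mathcal S_0=\{S_{0,1},S_{1,1},S_{1+\omega,1}\}$. Given $\mathcal S_n$, choose from it three mutually tangent spheres and add the two spheres just described, thus forming $\mathcal S_{n+1}$. This gives chains $\mathcal S_0\subset\mathcal S_1\subset\cdots$, and the set generated, $\mathcal G_\omega$, is the union of all the sets in all such chains.
   Formalization: The plane S_{1,0} belongs to P_ω and G_ω but not to B_ω, whose members have a+b+c>0 and are bounded spheres; the theorem proved is B_ω ∪ {S_{1,0}} = P_ω = G_ω. *)

theory Defs
  imports "HOL-Analysis.Analysis"
begin

text \<open>Three-space is \<^typ>\<open>complex \<times> real\<close>; its product metric is the Euclidean one.\<close>

type_synonym space3 = "complex \<times> real"

definition omega :: complex where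
  "omega = (- 1 + \<i> * of_real (sqrt 3)) / 2"

definition eisenstein :: "complex set" where
  "eisenstein = {of_int a + of_int b * omega | a b :: int. True}"

definition eis_dvd :: "complex \<Rightarrow> complex \<Rightarrow> bool" where
  "eis_dvd \<delta> \<alpha> \<longleftrightarrow> (\<exists>\<gamma>\<in>eisenstein. \<alpha> = \<delta> * \<gamma>)"

definition eis_unit :: "complex \<Rightarrow> bool" where
  "eis_unit \<delta> \<longleftrightarrow> \<delta> \<in> eisenstein \<and> eis_dvd \<delta> 1"

definition eis_coprime :: "complex \<Rightarrow> complex \<Rightarrow> bool" where
  "eis_coprime \<alpha> \<beta> \<longleftrightarrow>
     (\<forall>\<delta>\<in>eisenstein. eis_dvd \<delta> \<alpha> \<and> eis_dvd \<delta> \<beta> \<longrightarrow> eis_unit \<delta>)"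

definition base_sphere :: "complex \<Rightarrow> real \<Rightarrow> space3 set" where
  "base_sphere z r = sphere (z, r) r"

definition plane_at :: "real \<Rightarrow> space3 set" where
  "plane_at h = {p. snd p = h}"

text \<open>
  Planes parallel to the complex plane count as normal spheres, tangent to it at infinity.
  They lie above the complex plane, like the spheres: the complex plane itself is not normal.
\<close>

definition normal_sphere :: "space3 set \<Rightarrow> bool" where
  "normal_sphere A \<longleftrightarrow>
     (\<exists>z r. r > 0 \<and> A = base_sphere z r) \<or> (\<exists>h. h > 0 \<and> A = plane_at h)"

text \<open>
  Tangency is having exactly one common point in the one-point compactification of three-space,
  where \<^term>\<open>None\<close> is the point at infinity. So a sphere of positive radius or a plane is not
  tangent to itself, and two distinct parallel planes are tangent at infinity.
\<close>

definition extended :: "space3 set \<Rightarrow> space3 option set" where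
  "extended A = Some ` A \<union> (if bounded A then {} else {None})"

definition tangent :: "space3 set \<Rightarrow> space3 set \<Rightarrow> bool" where
  "tangent A B \<longleftrightarrow> (\<exists>p. extended A \<inter> extended B = {p})"

text \<open>
  The plane is prescribed for \<open>S\<^bsub>1,0\<^esub>\<close>. It is used for every \<open>S\<^bsub>\<alpha>,0\<^esub>\<close>: \<open>\<alpha>\<close> and \<open>0\<close> are
  relatively prime just when \<open>\<alpha>\<close> is a unit, and multiplying \<open>\<alpha>\<close> and \<open>\<beta>\<close> by a common unit
  leaves \<open>S\<^bsub>\<alpha>,\<beta>\<^esub>\<close> unchanged when \<open>\<beta> \<noteq> 0\<close>.
\<close>

definition S_frac :: "complex \<Rightarrow> complex \<Rightarrow> space3 set" where
  "S_frac \<alpha> \<beta> =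
     (if \<beta> = 0 then plane_at 1 else base_sphere (\<alpha> / \<beta>) (1 / (2 * (cmod \<beta>)\<^sup>2)))"

text \<open>Meaningful for \<open>a + b + c > 0\<close>.\<close>

definition S_bary :: "real \<Rightarrow> real \<Rightarrow> real \<Rightarrow> space3 set" where
  "S_bary a b c =
     base_sphere ((of_real b + of_real c * (1 + omega)) / of_real (a + b + c))
       (1 / (2 * (a + b + c)))"

definition P_omega :: "space3 set set" where
  "P_omega = {S_frac \<alpha> \<beta> | \<alpha> \<beta>. \<alpha> \<in> eisenstein \<and> \<beta> \<in> eisenstein \<and> eis_coprime \<alpha> \<beta>}"

text \<open>
  Every member is a genuine sphere, as \<open>a + b + c > 0\<close>. The other two families also contain
  the plane \<open>S\<^bsub>1,0\<^esub>\<close>, which would correspond to \<open>a = b = c = 0\<close>, \<open>d = \<plusminus>1\<close>.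
\<close>

definition B_omega :: "space3 set set" where
  "B_omega = {S_bary (of_int a) (of_int b) (of_int c) | a b c d :: int.
     Gcd {a, b, c, d} = 1 \<and> (a + b + c + d)\<^sup>2 = a\<^sup>2 + b\<^sup>2 + c\<^sup>2 + d\<^sup>2 \<and> a + b + c > 0}"

definition tetra_start :: "space3 set set" where
  "tetra_start = {S_frac 0 1, S_frac 1 1, S_frac (1 + omega) 1}"

text \<open>
  When \<open>A\<close>, \<open>B\<close>, \<open>C\<close> are not all tangent to the complex plane at one point, exactly two spheres
  are added. Triples with a common base point never occur in the chains below.
\<close>

definition tetra_step :: "space3 set set \<Rightarrow> space3 set set \<Rightarrow> bool" where
  "tetra_step \<S> \<S>' \<longleftrightarrow>
     (\<exists>A\<in>\<S>. \<exists>B\<in>\<S>. \<exists>C\<in>\<S>. tangent A B \<and> tangent A C \<and> tangent B C \<and>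
        \<S>' = \<S> \<union> {T. normal_sphere T \<and> tangent T A \<and> tangent T B \<and> tangent T C})"

definition tetra_chain :: "(nat \<Rightarrow> space3 set set) \<Rightarrow> bool" where
  "tetra_chain \<S> \<longleftrightarrow> \<S> 0 = tetra_start \<and> (\<forall>n. tetra_step (\<S> n) (\<S> (Suc n)))"

definition G_omega :: "space3 set set" where
  "G_omega = \<Union> {\<S> n | \<S> n. tetra_chain \<S>}"

end

theory Submission
  imports Defs
begin

text \<open>
  A nonzero pair \<open>(\<alpha>, \<beta>)\<close> of complex numbers determines the normal sphere \<open>horosphere \<alpha> \<beta>\<close>, which
  is \<open>S\<^bsub>\<alpha>,\<beta>\<^esub>\<close> extended to planes of any height; every normal sphere arises, and multiplying the
  pair by a number of modulus \<open>1\<close> does not change it. Two such spheres with different base points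
  are tangent exactly when the determinant \<open>\<alpha> * \<delta> - \<beta> * \<gamma>\<close> of their pairs has modulus \<open>1\<close>
  (\<open>tangent_horospheres\<close>). Tangency thereby becomes linear algebra over \<open>\<int>[\<omega>]\<close>, a ring with
  Euclidean division by the norm.

  Barycentric coordinates. For \<open>\<beta> \<noteq> 0\<close> put \<open>N = \<bar>\<beta>\<bar>\<^sup>2\<close>, \<open>M = \<bar>\<alpha>\<bar>\<^sup>2\<close> and
  \<open>\<alpha> * cnj \<beta> = b + c * (1 + \<omega>)\<close>. Then \<open>S\<^bsub>\<alpha>,\<beta>\<^esub>\<close> is \<open>\<langle>a, b, c\<rangle>\<close> with \<open>a = N - b - c\<close>, and with
  \<open>d = M - b - c\<close> the quadratic equation for \<open>a, b, c, d\<close> says that the Hermitian matrix with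
  diagonal \<open>M, N\<close> and off-diagonal entry \<open>\<alpha> * cnj \<beta>\<close> is singular. A Bezout identity for
  \<open>\<alpha>, \<beta>\<close> writes \<open>1\<close> as an integral combination of \<open>M, N, b, c\<close> (\<open>gram_common_factor\<close>), so coprime
  pairs give primitive quadruples. Conversely, reducing the base point of a quadruple to lowest
  terms gives a coprime pair whose own quadruple is proportional to the given one; as both are
  primitive, they agree.

  The procedure stays among coprime pairs. In the basis formed by the vectors of two of the three
  given spheres, the third vector and that of an added sphere both have coordinates of modulus
  \<open>1\<close>. Tangency of these two spheres leaves the vertices of an equilateral triangle, hence
  Eisenstein units, for the ratio of their coordinates (\<open>unit_triangle\<close>, \<open>fourth_horosphere\<close>).

  The procedure reaches all coprime pairs. If \<open>u, v\<close> have determinant of modulus \<open>1\<close>, the spheres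
  tangent to both of theirs include those of \<open>u + \<epsilon> * v\<close> for the six units \<open>\<epsilon>\<close>, cyclically tangent
  to one another, so one of them leads to the others. Thus the property that \<open>u, v\<close> and one such
  neighbour are reached survives exchanging \<open>u\<close> and \<open>v\<close> and adding multiples of \<open>u\<close> to \<open>v\<close>
  (\<open>linked_swap\<close>, \<open>linked_add_multiple\<close>). These are the moves of Euclid's algorithm, which brings
  \<open>x * u + y * v\<close> with coprime \<open>x, y\<close> to a unit multiple of a single reached vector
  (\<open>coprime_combination_in_G_omega\<close>).
\<close>

section \<open>Euclid's algorithm in the Eisenstein integers\<close>

lemma omega_Re_Im: "Re omega = - 1 / 2" "Im omega = sqrt 3 / 2"
  by (simp_all add: omega_def)

lemma omega_square: "omega * omega = - 1 - omega"
  by (simp add: complex_eq_iff omega_Re_Im)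

lemma cnj_omega: "cnj omega = - 1 - omega"
  by (simp add: complex_eq_iff omega_Re_Im)

lemma cmod_omega_combination:
  "(cmod (of_real x + of_real y * omega))\<^sup>2 = x\<^sup>2 - x * y + y\<^sup>2"
  by (simp add: cmod_power2 omega_Re_Im) (simp add: power2_eq_square field_simps)

lemma eisensteinI: "of_int a + of_int b * omega \<in> eisenstein"
  unfolding eisenstein_def by blast

lemma eisensteinE:
  assumes "x \<in> eisenstein"
  obtains a b where "x = of_int a + of_int b * omega"
  using assms unfolding eisenstein_def by blast

lemma eisenstein_of_int [simp]: "of_int n \<in> eisenstein"
  using eisensteinI[of n 0] by simp

lemma eisenstein_0 [simp]: "0 \<in> eisenstein"
  using eisenstein_of_int[of 0] by simp

lemma eisenstein_1 [simp]: "1 \<in> eisenstein"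
  using eisenstein_of_int[of 1] by simp

lemma eisenstein_omega [simp]: "omega \<in> eisenstein"
  using eisensteinI[of 0 1] by simp

lemma eisenstein_add [simp]:
  assumes "x \<in> eisenstein" "y \<in> eisenstein"
  shows "x + y \<in> eisenstein"
proof -
  from assms obtain a b c d where
    "x = of_int a + of_int b * omega" "y = of_int c + of_int d * omega"
    by (metis eisensteinE)
  then have "x + y = of_int (a + c) + of_int (b + d) * omega"
    by (simp add: algebra_simps)
  then show ?thesis by (metis eisensteinI)
qed

lemma eisenstein_mult [simp]:
  assumes "x \<in> eisenstein" "y \<in> eisenstein"
  shows "x * y \<in> eisenstein"
proof -
  from assms obtain a b c d where xy:
    "x = of_int a + of_int b * omega" "y = of_int c + of_int d * omega"
    by (metis eisensteinE)
  have "x * y = of_int a * of_int c + of_int (a * d + b * c) * omega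
      + of_int (b * d) * (omega * omega)"
    by (simp add: xy algebra_simps)
  also have "\<dots> = of_int (a * c - b * d) + of_int (a * d + b * c - b * d) * omega"
    by (simp add: omega_square algebra_simps)
  finally show ?thesis by (metis eisensteinI)
qed

lemma eisenstein_uminus [simp]: "x \<in> eisenstein \<Longrightarrow> - x \<in> eisenstein"
  using eisenstein_mult[OF eisenstein_of_int[of "- 1"]] by simp

lemma eisenstein_diff [simp]:
  "x \<in> eisenstein \<Longrightarrow> y \<in> eisenstein \<Longrightarrow> x - y \<in> eisenstein"
  using eisenstein_add[of x "- y"] by simp

lemma eisenstein_cnj [simp]: "x \<in> eisenstein \<Longrightarrow> cnj x \<in> eisenstein"
  by (auto simp: cnj_omega elim!: eisensteinE)

lemma eisenstein_norm:
  assumes "x \<in> eisenstein"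
  obtains n :: int where "(cmod x)\<^sup>2 = of_int n" "n \<ge> 0"
proof -
  from assms obtain a b where x: "x = of_int a + of_int b * omega"
    by (rule eisensteinE)
  have n: "(cmod x)\<^sup>2 = of_int (a\<^sup>2 - a * b + b\<^sup>2)"
    using cmod_omega_combination[of "of_int a" "of_int b"] by (simp add: x)
  then have "a\<^sup>2 - a * b + b\<^sup>2 \<ge> 0"
    by (metis of_int_0_le_iff zero_le_power2)
  with n that show ?thesis by blast
qed

lemma eisenstein_trace:
  assumes "x \<in> eisenstein"
  obtains n :: int where "x + cnj x = of_int n"
proof -
  from assms obtain a b where "x = of_int a + of_int b * omega"
    by (rule eisensteinE)
  then have "x + cnj x = of_int (2 * a - b)"
    by (simp add: cnj_omega algebra_simps)
  with that show ?thesis by blast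
qed

text \<open>
  Rounding both coordinates of \<open>\<alpha> / \<beta>\<close> in the basis \<open>1, \<omega>\<close> leaves \<open>x + y * \<omega>\<close> with
  \<open>\<bar>x\<bar>, \<bar>y\<bar> \<le> 1/2\<close>, whose squared modulus \<open>x\<^sup>2 - x * y + y\<^sup>2\<close> is at most \<open>3/4\<close>.
\<close>

lemma eisenstein_division:
  assumes "\<beta> \<noteq> 0"
  obtains q where "q \<in> eisenstein" "cmod (\<alpha> - q * \<beta>) < cmod \<beta>"
proof -
  define t where "t = Im (\<alpha> / \<beta>) * 2 / sqrt 3"
  define s where "s = Re (\<alpha> / \<beta>) + t / 2"
  have st: "\<alpha> / \<beta> = of_real s + of_real t * omega"
    by (simp add: complex_eq_iff omega_Re_Im s_def t_def)
  define q where "q = of_int (round s) + of_int (round t) * omega"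
  define x where "x = s - of_int (round s)"
  define y where "y = t - of_int (round t)"
  have x: "\<bar>x\<bar> \<le> 1 / 2" and y: "\<bar>y\<bar> \<le> 1 / 2"
    using of_int_round_abs_le[of s] of_int_round_abs_le[of t]
    by (auto simp: x_def y_def abs_minus_commute)
  have "(cmod (\<alpha> / \<beta> - q))\<^sup>2 = x\<^sup>2 - x * y + y\<^sup>2"
  proof -
    have "\<alpha> / \<beta> - q = of_real x + of_real y * omega"
      by (simp add: st q_def x_def y_def algebra_simps)
    then show ?thesis by (simp only: cmod_omega_combination)
  qed
  also have "\<dots> < 1"
  proof -
    have "x\<^sup>2 \<le> 1 / 4" "y\<^sup>2 \<le> 1 / 4"
      using power_mono[OF x, of 2] power_mono[OF y, of 2] by (auto simp: power2_eq_square)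
    moreover have "\<bar>x\<bar> * \<bar>y\<bar> \<le> 1 / 2 * (1 / 2)"
      by (rule mult_mono) (use x y in auto)
    then have "- (x * y) \<le> 1 / 4" by (simp flip: abs_mult)
    ultimately show ?thesis by linarith
  qed
  finally have "cmod (\<alpha> / \<beta> - q) < 1"
    by (metis abs_norm_cancel abs_square_less_1)
  then have "cmod (\<alpha> / \<beta> - q) * cmod \<beta> < cmod \<beta>" using assms by simp
  moreover have "\<alpha> - q * \<beta> = (\<alpha> / \<beta> - q) * \<beta>" using assms by (simp add: field_simps)
  ultimately have "cmod (\<alpha> - q * \<beta>) < cmod \<beta>" by (simp add: norm_mult)
  with that show ?thesis using eisensteinI q_def by blast
qed

text \<open>
  Euclid's algorithm as an induction rule. It terminates because squared moduli of Eisenstein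
  integers are natural numbers. The rule serves both the Bezout identity and the descent through
  the tetrahedral procedure.
\<close>

lemma eisenstein_euclid_induct [consumes 2, case_names zero step]:
  assumes "\<alpha> \<in> eisenstein" "\<beta> \<in> eisenstein"
    and zero: "\<And>\<alpha>. \<alpha> \<in> eisenstein \<Longrightarrow> P \<alpha> 0"
    and step: "\<And>\<alpha> \<beta> q. \<alpha> \<in> eisenstein \<Longrightarrow> \<beta> \<in> eisenstein \<Longrightarrow> q \<in> eisenstein
      \<Longrightarrow> P \<beta> (\<alpha> - q * \<beta>) \<Longrightarrow> P \<alpha> \<beta>"
  shows "P \<alpha> \<beta>"
  using assms(1,2)
proof (induction "nat \<lfloor>(cmod \<beta>)\<^sup>2\<rfloor>" arbitrary: \<alpha> \<beta> rule: less_induct)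
  case less
  show ?case
  proof (cases "\<beta> = 0")
    case False
    then obtain q where q: "q \<in> eisenstein" and lt: "cmod (\<alpha> - q * \<beta>) < cmod \<beta>"
      by (rule eisenstein_division)
    let ?\<rho> = "\<alpha> - q * \<beta>"
    have \<rho>: "?\<rho> \<in> eisenstein" using less.prems q by simp
    obtain m n :: int where "(cmod ?\<rho>)\<^sup>2 = of_int m" "m \<ge> 0" "(cmod \<beta>)\<^sup>2 = of_int n" "n \<ge> 0"
      using \<rho> less.prems by (metis eisenstein_norm)
    moreover have "(cmod ?\<rho>)\<^sup>2 < (cmod \<beta>)\<^sup>2"
      using lt by (simp add: power_strict_mono)
    ultimately have "nat \<lfloor>(cmod ?\<rho>)\<^sup>2\<rfloor> < nat \<lfloor>(cmod \<beta>)\<^sup>2\<rfloor>" by simp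
    from less.hyps[OF this less.prems(2) \<rho>] show ?thesis
      using step less.prems q by blast
  qed (use less.prems zero in simp)
qed

lemma eisenstein_bezout:
  assumes "\<alpha> \<in> eisenstein" "\<beta> \<in> eisenstein"
  shows "\<exists>x\<in>eisenstein. \<exists>y\<in>eisenstein.
    eis_dvd (x * \<alpha> + y * \<beta>) \<alpha> \<and> eis_dvd (x * \<alpha> + y * \<beta>) \<beta>"
  using assms
proof (induction rule: eisenstein_euclid_induct)
  case (zero \<alpha>)
  show ?case
    by (rule bexI[of _ 1], rule bexI[of _ 0])
      (auto simp: eis_dvd_def intro: bexI[of _ 1] bexI[of _ 0])
next
  case (step \<alpha> \<beta> q)
  then obtain x y where xy: "x \<in> eisenstein" "y \<in> eisenstein"
    and d: "eis_dvd (x * \<beta> + y * (\<alpha> - q * \<beta>)) \<beta>"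
      "eis_dvd (x * \<beta> + y * (\<alpha> - q * \<beta>)) (\<alpha> - q * \<beta>)"
    by blast
  let ?g = "y * \<alpha> + (x - y * q) * \<beta>"
  have g: "x * \<beta> + y * (\<alpha> - q * \<beta>) = ?g" by (simp add: algebra_simps)
  from d[unfolded g] obtain s t where st: "s \<in> eisenstein" "t \<in> eisenstein"
      "\<beta> = ?g * s" "\<alpha> - q * \<beta> = ?g * t"
    unfolding eis_dvd_def by blast
  have "\<alpha> = ?g * (t + q * s)"
  proof -
    have "\<alpha> = (\<alpha> - q * \<beta>) + q * \<beta>" by simp
    also have "\<dots> = ?g * t + q * (?g * s)" using st(3,4) by presburger
    finally show ?thesis by (simp add: algebra_simps)
  qed
  then have "eis_dvd ?g \<alpha>" using st step(3) unfolding eis_dvd_def by force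
  moreover have "eis_dvd ?g \<beta>" using d(1) g by simp
  ultimately show ?case using xy step(3) by (intro bexI[of _ y] bexI[of _ "x - y * q"]) auto
qed

lemma eis_unit_cmod:
  assumes "eis_unit \<delta>"
  shows "cmod \<delta> = 1"
proof -
  from assms obtain \<gamma> where \<gamma>: "\<delta> \<in> eisenstein" "\<gamma> \<in> eisenstein" "1 = \<delta> * \<gamma>"
    unfolding eis_unit_def eis_dvd_def by blast
  then obtain m n :: int where mn: "(cmod \<delta>)\<^sup>2 = of_int m" "m \<ge> 0" "(cmod \<gamma>)\<^sup>2 = of_int n"
    by (metis eisenstein_norm)
  have "(cmod \<delta>)\<^sup>2 * (cmod \<gamma>)\<^sup>2 = 1"
    using \<gamma>(3) by (metis norm_mult norm_one power_mult_distrib power_one)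
  then have "m * n = 1" using mn by (metis of_int_eq_1_iff of_int_mult)
  then have "m = 1" using mn(2) by (metis abs_of_nonneg zmult_eq_1_iff abs_minus_cancel abs_1)
  then have "(cmod \<delta>)\<^sup>2 = 1\<^sup>2" using mn(1) by simp
  then show ?thesis by (simp only: power2_eq_iff_nonneg norm_ge_zero zero_le_one)
qed

lemma cmod_1_eis_unit:
  assumes "\<delta> \<in> eisenstein" "cmod \<delta> = 1"
  shows "eis_unit \<delta>"
proof -
  have "1 = \<delta> * cnj \<delta>" using assms(2) by (simp add: complex_norm_square[symmetric])
  then show ?thesis using assms(1) unfolding eis_unit_def eis_dvd_def by auto
qed

lemma eis_coprime_bezout:
  assumes "\<alpha> \<in> eisenstein" "\<beta> \<in> eisenstein" "eis_coprime \<alpha> \<beta>"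
  obtains x y where "x \<in> eisenstein" "y \<in> eisenstein" "x * \<alpha> + y * \<beta> = 1"
proof -
  obtain x y where xy: "x \<in> eisenstein" "y \<in> eisenstein"
      "eis_dvd (x * \<alpha> + y * \<beta>) \<alpha>" "eis_dvd (x * \<alpha> + y * \<beta>) \<beta>"
    using eisenstein_bezout[OF assms(1,2)] by blast
  then have "eis_unit (x * \<alpha> + y * \<beta>)"
    using assms unfolding eis_coprime_def by simp
  then obtain z where z: "z \<in> eisenstein" "1 = (x * \<alpha> + y * \<beta>) * z"
    unfolding eis_unit_def eis_dvd_def by blast
  then have "z * x * \<alpha> + z * y * \<beta> = 1" by (simp add: algebra_simps)
  with xy z that show ?thesis by (meson eisenstein_mult)
qed

lemma bezout_eis_coprime:
  assumes "x \<in> eisenstein" "y \<in> eisenstein" "eis_unit (x * \<alpha> + y * \<beta>)"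
  shows "eis_coprime \<alpha> \<beta>"
  unfolding eis_coprime_def
proof (intro ballI impI)
  fix \<delta> assume \<delta>: "\<delta> \<in> eisenstein" and "eis_dvd \<delta> \<alpha> \<and> eis_dvd \<delta> \<beta>"
  then obtain s t z where st: "s \<in> eisenstein" "t \<in> eisenstein" "\<alpha> = \<delta> * s" "\<beta> = \<delta> * t"
    and z: "z \<in> eisenstein" "1 = (x * \<alpha> + y * \<beta>) * z"
    using assms(3) unfolding eis_unit_def eis_dvd_def by blast
  have "1 = \<delta> * ((x * s + y * t) * z)"
    using z(2) unfolding st(3,4) by (simp add: algebra_simps)
  moreover have "(x * s + y * t) * z \<in> eisenstein" using assms st z by simp
  ultimately show "eis_unit \<delta>" using \<delta> unfolding eis_unit_def eis_dvd_def by blast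
qed

lemma eis_coprime_0:
  assumes "\<alpha> \<in> eisenstein" "eis_coprime \<alpha> 0"
  shows "eis_unit \<alpha>"
proof -
  have "eis_dvd \<alpha> \<alpha>" "eis_dvd \<alpha> 0"
    unfolding eis_dvd_def by (auto intro: bexI[of _ 1] bexI[of _ 0])
  then show ?thesis using assms unfolding eis_coprime_def by blast
qed

section \<open>Tangency of horospheres\<close>

text \<open>
  For \<open>\<beta> = 0\<close> the height \<open>\<bar>\<alpha>\<bar>\<^sup>2\<close> is the one for which the determinant criterion of tangency holds
  for planes too: the sphere of \<open>(\<gamma>, \<delta>)\<close> has its top at height \<open>1 / \<bar>\<delta>\<bar>\<^sup>2\<close>.
\<close>

definition horosphere :: "complex \<Rightarrow> complex \<Rightarrow> space3 set" where
  "horosphere \<alpha> \<beta> = (if \<beta> = 0 then plane_at ((cmod \<alpha>)\<^sup>2)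
     else base_sphere (\<alpha> / \<beta>) (1 / (2 * (cmod \<beta>)\<^sup>2)))"

lemma horosphere_rotate:
  assumes "cmod \<kappa> = 1"
  shows "horosphere (\<kappa> * \<alpha>) (\<kappa> * \<beta>) = horosphere \<alpha> \<beta>"
proof -
  have "\<kappa> \<noteq> 0" using assms by auto
  then show ?thesis using assms by (simp add: horosphere_def norm_mult)
qed

lemma normal_sphere_iff_horosphere:
  "normal_sphere A \<longleftrightarrow> (\<exists>\<alpha> \<beta>. (\<alpha> \<noteq> 0 \<or> \<beta> \<noteq> 0) \<and> A = horosphere \<alpha> \<beta>)"
proof
  assume "normal_sphere A"
  then consider z r where "r > 0" "A = base_sphere z r" | h where "h > 0" "A = plane_at h"
    unfolding normal_sphere_def by blast
  then show "\<exists>\<alpha> \<beta>. (\<alpha> \<noteq> 0 \<or> \<beta> \<noteq> 0) \<and> A = horosphere \<alpha> \<beta>"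
  proof cases
    case 1
    let ?\<beta> = "complex_of_real (1 / sqrt (2 * r))"
    have "A = horosphere (z * ?\<beta>) ?\<beta>"
      using 1 by (simp add: horosphere_def norm_divide power_divide)
    moreover have "?\<beta> \<noteq> 0" using 1 by simp
    ultimately show ?thesis by blast
  next
    case 2
    then have "A = horosphere (of_real (sqrt h)) 0" by (simp add: horosphere_def)
    moreover have "complex_of_real (sqrt h) \<noteq> 0" using 2 by simp
    ultimately show ?thesis by blast
  qed
next
  assume "\<exists>\<alpha> \<beta>. (\<alpha> \<noteq> 0 \<or> \<beta> \<noteq> 0) \<and> A = horosphere \<alpha> \<beta>"
  then obtain \<alpha> \<beta> where ab: "\<alpha> \<noteq> 0 \<or> \<beta> \<noteq> 0" "A = horosphere \<alpha> \<beta>" by blast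
  show "normal_sphere A"
  proof (cases "\<beta> = 0")
    case True
    then have "(cmod \<alpha>)\<^sup>2 > 0" using ab by simp
    moreover have "A = plane_at ((cmod \<alpha>)\<^sup>2)" using True ab by (simp add: horosphere_def)
    ultimately show ?thesis unfolding normal_sphere_def by blast
  next
    case False
    then have "1 / (2 * (cmod \<beta>)\<^sup>2) > 0" by simp
    moreover have "A = base_sphere (\<alpha> / \<beta>) (1 / (2 * (cmod \<beta>)\<^sup>2))"
      using False ab by (simp add: horosphere_def)
    ultimately show ?thesis unfolding normal_sphere_def by blast
  qed
qed

text \<open>
  The reflection of a common point in the line through the centers is again a common point. If
  there is only one, it lies on that line, and its distances to the centers add up to, or differ
  by, the distance of the centers.
\<close>

lemma spheres_one_common_point_dist:
  fixes c d :: "'a::real_inner"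
  assumes "c \<noteq> d" "sphere c r \<inter> sphere d s = {p}"
  shows "dist c d = r + s \<or> dist c d = \<bar>r - s\<bar>"
proof -
  define e where "e = d - c"
  define t where "t = (p - c) \<bullet> e / (e \<bullet> e)"
  \<comment> \<open>The reflection of \<open>p\<close> in the line through the centers.\<close>
  define p' where "p' = c + (2 * t) *\<^sub>R e - (p - c)"
  have e: "e \<bullet> e > 0" using assms(1) by (simp add: e_def)
  have te: "t * (e \<bullet> e) = (p - c) \<bullet> e" using e by (simp add: t_def)
  have p: "dist c p = r" "dist d p = s" using assms(2) by auto
  have 1: "dist c p' = dist c p"
  proof -
    have "(p' - c) \<bullet> (p' - c) = (p - c) \<bullet> (p - c) + 4 * t * (t * (e \<bullet> e) - (p - c) \<bullet> e)"
      by (simp add: p'_def inner_diff inner_add algebra_simps inner_commute)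
    then have "norm (p' - c) = norm (p - c)" using te by (simp add: norm_eq_sqrt_inner)
    then show ?thesis by (metis dist_commute dist_norm)
  qed
  have 2: "dist d p' = dist d p"
  proof -
    have *: "((2 * t - 1) *\<^sub>R e - u) \<bullet> ((2 * t - 1) *\<^sub>R e - u) =
        (u - e) \<bullet> (u - e) + 4 * (t - 1) * (t * (e \<bullet> e) - u \<bullet> e)" for u
      by (simp add: inner_diff_left inner_diff_right algebra_simps inner_commute)
    have "p' - d = (2 * t - 1) *\<^sub>R e - (p - c)" "p - d = (p - c) - e"
      by (simp_all add: p'_def e_def algebra_simps)
    then have "(p' - d) \<bullet> (p' - d) = (p - d) \<bullet> (p - d)"
      using *[of "p - c"] te by (simp only: diff_self mult_zero_right add_0_right)
    then have "norm (p' - d) = norm (p - d)" by (simp add: norm_eq_sqrt_inner)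
    then show ?thesis by (metis dist_commute dist_norm)
  qed
  have "p' \<in> sphere c r \<inter> sphere d s" using 1 2 p by simp
  then have "p' = p" using assms(2) by blast
  then have "p - p' = 0" by simp
  moreover have "p - p' = 2 *\<^sub>R (p - c - t *\<^sub>R e)" by (simp add: p'_def scaleR_2 algebra_simps)
  ultimately have "p - c - t *\<^sub>R e = 0" by simp
  then have pc: "p - c = t *\<^sub>R e" by simp
  have "r = \<bar>t\<bar> * norm e" using p(1) pc by (metis dist_commute dist_norm norm_scaleR)
  moreover have "s = \<bar>1 - t\<bar> * norm e"
  proof -
    have "d - p = (1 - t) *\<^sub>R e" using pc by (simp add: e_def algebra_simps)
    then show ?thesis using p(2) by (metis dist_norm norm_scaleR)
  qed
  moreover have "dist c d = norm e" by (simp add: e_def dist_norm norm_minus_commute)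
  ultimately show ?thesis
    by (auto simp: abs_if algebra_simps split: if_splits)
qed

text \<open>
  In this form, tangency to the complex plane has removed the constant term: intersecting two
  normal spheres with the same base point, or one with a plane, becomes immediate.
\<close>

lemma base_sphere_iff:
  assumes "r > 0"
  shows "(p, h) \<in> base_sphere z r \<longleftrightarrow> (cmod (p - z))\<^sup>2 + h\<^sup>2 = 2 * r * h"
proof -
  have "(p, h) \<in> base_sphere z r \<longleftrightarrow> (dist (z, r) (p, h))\<^sup>2 = r\<^sup>2"
    using assms by (simp add: base_sphere_def power2_eq_iff_nonneg)
  also have "(dist (z, r) (p, h))\<^sup>2 = (cmod (p - z))\<^sup>2 + (h - r)\<^sup>2"
    by (simp add: dist_Pair_Pair dist_norm[where ?'a = complex] norm_minus_commute dist_real_def power2_commute)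
  also have "(\<dots> = r\<^sup>2) \<longleftrightarrow> (cmod (p - z))\<^sup>2 + h\<^sup>2 = 2 * r * h"
    by (auto simp: power2_eq_square algebra_simps)
  finally show ?thesis .
qed

lemma tangent_bounded:
  assumes "bounded A"
  shows "tangent A B \<longleftrightarrow> (\<exists>p. A \<inter> B = {p})"
proof -
  have "extended A \<inter> extended B = Some ` (A \<inter> B)"
    using assms by (auto simp: extended_def)
  moreover have "(\<exists>q. Some ` X = {q}) \<longleftrightarrow> (\<exists>p. X = {p})" for X :: "space3 set"
  proof
    assume "\<exists>q. Some ` X = {q}"
    then obtain q where q: "Some ` X = {q}" by blast
    then obtain p where "p \<in> X" by blast
    moreover have "x = p" if "x \<in> X" for x
      using q that \<open>p \<in> X\<close> by (metis imageI option.inject singletonD)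
    ultimately show "\<exists>p. X = {p}" by blast
  qed auto
  ultimately show ?thesis unfolding tangent_def by simp
qed

text \<open>
  By Stewart's theorem, the distance from a common point \<open>p\<close> to the point \<open>q\<close> at the parameter
  \<open>t = r / (r + s)\<close> of the segment between the centers satisfies
  \<open>\<bar>p - q\<bar>\<^sup>2 = (1 - t) * r\<^sup>2 + t * s\<^sup>2 - t * (1 - t) * (r + s)\<^sup>2\<close>, which vanishes.
\<close>

lemma externally_tangent_spheres:
  fixes c d :: "'a::real_inner"
  assumes "r > 0" "s > 0" "dist c d = r + s"
  shows "sphere c r \<inter> sphere d s = {c + (r / (r + s)) *\<^sub>R (d - c)}"
proof -
  define t where "t = r / (r + s)"
  define q where "q = c + t *\<^sub>R (d - c)"
  have t: "0 < t" "t < 1" "t * (r + s) = r" "(1 - t) * (r + s) = s"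
    using assms by (simp_all add: t_def field_simps)
  have cq: "dist c q = r"
  proof -
    have "dist c q = t * dist c d" using t by (simp add: q_def dist_norm norm_minus_commute)
    then show ?thesis using t assms by simp
  qed
  have dq: "dist d q = s"
  proof -
    have "d - q = (1 - t) *\<^sub>R (d - c)" by (simp add: q_def algebra_simps)
    then have "dist d q = (1 - t) * dist c d" using t by (simp add: dist_norm norm_minus_commute)
    then show ?thesis using t assms by simp
  qed
  have unique: "p = q" if "dist c p = r" "dist d p = s" for p
  proof -
    have uu: "(p - c) \<bullet> (p - c) = r\<^sup>2" and vv: "(p - d) \<bullet> (p - d) = s\<^sup>2"
      using that by (simp_all add: power2_norm_eq_inner[symmetric] dist_norm norm_minus_commute)
    have "((p - c) - (p - d)) \<bullet> ((p - c) - (p - d)) = (r + s)\<^sup>2"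
      using assms(3) by (simp add: power2_norm_eq_inner[symmetric] dist_norm norm_minus_commute)
    then have uv: "2 * ((p - c) \<bullet> (p - d)) = r\<^sup>2 + s\<^sup>2 - (r + s)\<^sup>2"
      using uu vv by (simp add: inner_diff_left inner_diff_right inner_commute)
    have "p - q = (1 - t) *\<^sub>R (p - c) + t *\<^sub>R (p - d)"
      by (simp add: q_def algebra_simps)
    then have "(p - q) \<bullet> (p - q) = (1 - t)\<^sup>2 * ((p - c) \<bullet> (p - c)) + t\<^sup>2 * ((p - d) \<bullet> (p - d))
        + (1 - t) * t * (2 * ((p - c) \<bullet> (p - d)))"
      by (simp only: inner_add_left inner_add_right inner_scaleR_left inner_scaleR_right
          inner_commute[of "p - d" "p - c"] power2_eq_square)
        (simp add: algebra_simps)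
    also have "\<dots> = (1 - t)\<^sup>2 * r\<^sup>2 + t\<^sup>2 * s\<^sup>2 + (1 - t) * t * (r\<^sup>2 + s\<^sup>2 - (r + s)\<^sup>2)"
      by (simp only: uu vv uv)
    also have "\<dots> = ((1 - t) * r - t * s)\<^sup>2"
      by (simp add: power2_eq_square algebra_simps)
    also have "(1 - t) * r - t * s = 0" using t(3) by (simp add: algebra_simps)
    finally show ?thesis by simp
  qed
  have "sphere c r \<inter> sphere d s = {q}"
  proof (intro equalityI subsetI)
    show "p \<in> {q}" if "p \<in> sphere c r \<inter> sphere d s" for p
      using unique[of p] that by simp
    show "p \<in> sphere c r \<inter> sphere d s" if "p \<in> {q}" for p
      using cq dq that by simp
  qed
  then show ?thesis by (simp only: q_def t_def)
qed

lemma tangent_commute: "tangent A B \<longleftrightarrow> tangent B A"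
  by (simp add: tangent_def Int_commute)

text \<open>
  The squared distance of the centers is \<open>\<bar>z - w\<bar>\<^sup>2 + (r - s)\<^sup>2\<close>. Equating it to \<open>(r + s)\<^sup>2\<close> gives the
  first alternative; equating it to \<open>(r - s)\<^sup>2\<close>, the case of internal contact, forces \<open>z = w\<close>.
\<close>

lemma tangent_base_spheres:
  assumes "r > 0" "s > 0"
  shows "tangent (base_sphere z r) (base_sphere w s) \<longleftrightarrow>
    (cmod (z - w))\<^sup>2 = 4 * r * s \<or> (z = w \<and> r \<noteq> s)"
proof -
  have dist2: "(dist (z, r) (w, s))\<^sup>2 = (cmod (z - w))\<^sup>2 + (r - s)\<^sup>2"
    by (simp add: dist_Pair_Pair dist_norm[where ?'a = complex] dist_real_def)
  have ext: "dist (z, r) (w, s) = r + s \<longleftrightarrow> (cmod (z - w))\<^sup>2 = 4 * r * s"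
  proof -
    have "dist (z, r) (w, s) = r + s \<longleftrightarrow> (dist (z, r) (w, s))\<^sup>2 = (r + s)\<^sup>2"
      using assms by (simp add: power2_eq_iff_nonneg)
    also have "\<dots> \<longleftrightarrow> (cmod (z - w))\<^sup>2 = 4 * r * s"
      unfolding dist2 by (auto simp: power2_eq_square algebra_simps)
    finally show ?thesis .
  qed
  have "bounded (base_sphere z r)"
    by (simp add: base_sphere_def)
  note tang = tangent_bounded[OF this, of "base_sphere w s"]
  have same: "tangent (base_sphere z r) (base_sphere w s) \<longleftrightarrow> r \<noteq> s" if "z = w"
  proof (cases "r = s")
    case True
    have "(z, 0) \<in> base_sphere z r" "(z, 2 * r) \<in> base_sphere z r"
      using assms by (simp_all add: base_sphere_iff power2_eq_square)
    then show ?thesis using True that assms tang by auto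
  next
    case False
    have "base_sphere z r \<inter> base_sphere z s = {(z, 0)}"
      using False assms by (auto simp: base_sphere_iff)
    then show ?thesis using False that tang by auto
  qed
  have diff: "tangent (base_sphere z r) (base_sphere w s) \<longleftrightarrow> dist (z, r) (w, s) = r + s"
    if "z \<noteq> w"
  proof
    assume "tangent (base_sphere z r) (base_sphere w s)"
    then obtain p where "sphere (z, r) r \<inter> sphere (w, s) s = {p}"
      using tang unfolding base_sphere_def by blast
    then have "dist (z, r) (w, s) = r + s \<or> dist (z, r) (w, s) = \<bar>r - s\<bar>"
      using that by (intro spheres_one_common_point_dist) auto
    moreover have "dist (z, r) (w, s) \<noteq> \<bar>r - s\<bar>"
      using dist2 that by auto
    ultimately show "dist (z, r) (w, s) = r + s" by blast
  next
    assume "dist (z, r) (w, s) = r + s"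
    then show "tangent (base_sphere z r) (base_sphere w s)"
      using externally_tangent_spheres[of r s "(z, r)" "(w, s)"] assms tang
      unfolding base_sphere_def by blast
  qed
  show ?thesis using same diff ext assms by (cases "z = w") auto
qed

lemma tangent_base_sphere_plane:
  assumes "r > 0" "h > 0"
  shows "tangent (base_sphere z r) (plane_at h) \<longleftrightarrow> h = 2 * r"
proof -
  have "bounded (base_sphere z r)"
    by (simp add: base_sphere_def)
  note tang = tangent_bounded[OF this, of "plane_at h"]
  have mem: "(p, k) \<in> base_sphere z r \<inter> plane_at h \<longleftrightarrow>
      k = h \<and> (cmod (p - z))\<^sup>2 = h * (2 * r - h)" for p k
    using assms by (auto simp: base_sphere_iff plane_at_def power2_eq_square algebra_simps)
  show ?thesis
  proof
    assume "tangent (base_sphere z r) (plane_at h)"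
    then obtain p k where pk: "base_sphere z r \<inter> plane_at h = {(p, k)}"
      using tang by auto
    then have "(p, k) \<in> base_sphere z r \<inter> plane_at h" by simp
    with mem have k: "k = h" and p: "(cmod (p - z))\<^sup>2 = h * (2 * r - h)" by blast+
    \<comment> \<open>The circle in which sphere and plane meet is symmetric about its center.\<close>
    have "cmod (2 * z - p - z) = cmod (p - z)"
      by (metis add_diff_cancel_right' diff_diff_eq mult_2 norm_minus_commute)
    then have "(2 * z - p, h) \<in> base_sphere z r \<inter> plane_at h" using mem p by simp
    then have "2 * z - p = p" using pk by auto
    then have "p = z" by simp
    then show "h = 2 * r" using p assms by simp
  next
    assume "h = 2 * r"
    then have "base_sphere z r \<inter> plane_at h = {(z, h)}" using mem by auto
    then show "tangent (base_sphere z r) (plane_at h)" using tang by blast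
  qed
qed

lemma tangent_planes: "tangent (plane_at h) (plane_at k) \<longleftrightarrow> h \<noteq> k"
proof -
  have unbounded: "\<not> bounded (plane_at l)" for l
  proof
    assume "bounded (plane_at l)"
    then have "bounded (fst ` plane_at l)" by (rule bounded_fst)
    moreover have "z \<in> fst ` plane_at l" for z
      by (rule image_eqI[of _ _ "(z, l)"]) (simp_all add: plane_at_def)
    then have "fst ` plane_at l = UNIV" by blast
    ultimately show False by simp
  qed
  have eq: "extended (plane_at h) \<inter> extended (plane_at k) =
      insert None (Some ` (plane_at h \<inter> plane_at k))"
    using unbounded by (auto simp: extended_def)
  show ?thesis
  proof (cases "h = k")
    case True
    then have "(0, h) \<in> plane_at h \<inter> plane_at k" by (simp add: plane_at_def)
    then have "Some (0, h) \<in> extended (plane_at h) \<inter> extended (plane_at k)"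
      "None \<in> extended (plane_at h) \<inter> extended (plane_at k)"
      unfolding eq by blast+
    then show ?thesis using True unfolding tangent_def
      by (metis option.distinct(1) singletonD)
  next
    case False
    then have "plane_at h \<inter> plane_at k = {}" by (auto simp: plane_at_def)
    then show ?thesis using False eq unfolding tangent_def by auto
  qed
qed

lemma tangent_self: "\<not> tangent (horosphere \<alpha> \<beta>) (horosphere \<alpha> \<beta>)"
  using tangent_base_spheres tangent_planes by (auto simp: horosphere_def)

text \<open>
  For two spheres \<open>\<bar>\<alpha> / \<beta> - \<gamma> / \<delta>\<bar>\<^sup>2 = 4 * r * s\<close> with \<open>r = 1 / (2 * \<bar>\<beta>\<bar>\<^sup>2)\<close> and
  \<open>s = 1 / (2 * \<bar>\<delta>\<bar>\<^sup>2)\<close> becomes the determinant condition after clearing denominators. Determinant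
  \<open>0\<close> means a common base point (for planes, the one at infinity), where any two distinct spheres
  are tangent.
\<close>

lemma tangent_horospheres:
  assumes "\<alpha> \<noteq> 0 \<or> \<beta> \<noteq> 0" "\<gamma> \<noteq> 0 \<or> \<delta> \<noteq> 0" "\<alpha> * \<delta> \<noteq> \<beta> * \<gamma>"
  shows "tangent (horosphere \<alpha> \<beta>) (horosphere \<gamma> \<delta>) \<longleftrightarrow> cmod (\<alpha> * \<delta> - \<beta> * \<gamma>) = 1"
proof -
  have sq: "cmod (\<alpha> * \<delta> - \<beta> * \<gamma>) = 1 \<longleftrightarrow> (cmod (\<alpha> * \<delta> - \<beta> * \<gamma>))\<^sup>2 = 1"
    using power2_eq_iff_nonneg[of "cmod (\<alpha> * \<delta> - \<beta> * \<gamma>)" 1] by simp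
  consider "\<beta> = 0" "\<delta> \<noteq> 0" | "\<beta> \<noteq> 0" "\<delta> = 0" | "\<beta> \<noteq> 0" "\<delta> \<noteq> 0"
    using assms by fastforce
  then show ?thesis
  proof cases
    case 1
    then have "tangent (horosphere \<alpha> \<beta>) (horosphere \<gamma> \<delta>) \<longleftrightarrow> (cmod \<alpha>)\<^sup>2 = 1 / (cmod \<delta>)\<^sup>2"
      using assms tangent_base_sphere_plane[of "1 / (2 * (cmod \<delta>)\<^sup>2)" "(cmod \<alpha>)\<^sup>2"]
      by (subst tangent_commute) (simp add: horosphere_def)
    then show ?thesis unfolding sq using 1 by (simp add: norm_mult power_mult_distrib field_simps)
  next
    case 2
    then have "tangent (horosphere \<alpha> \<beta>) (horosphere \<gamma> \<delta>) \<longleftrightarrow> (cmod \<gamma>)\<^sup>2 = 1 / (cmod \<beta>)\<^sup>2"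
      using assms tangent_base_sphere_plane[of "1 / (2 * (cmod \<beta>)\<^sup>2)" "(cmod \<gamma>)\<^sup>2"]
      by (simp add: horosphere_def)
    then show ?thesis unfolding sq using 2 by (simp add: norm_mult power_mult_distrib field_simps)
  next
    case 3
    have "\<alpha> / \<beta> \<noteq> \<gamma> / \<delta>" using 3 assms(3) by (simp add: frac_eq_eq mult.commute)
    then have "tangent (horosphere \<alpha> \<beta>) (horosphere \<gamma> \<delta>) \<longleftrightarrow>
        (cmod (\<alpha> / \<beta> - \<gamma> / \<delta>))\<^sup>2 = 1 / ((cmod \<beta>)\<^sup>2 * (cmod \<delta>)\<^sup>2)"
      using 3 by (simp add: horosphere_def tangent_base_spheres)
    moreover have "\<alpha> / \<beta> - \<gamma> / \<delta> = (\<alpha> * \<delta> - \<beta> * \<gamma>) / (\<beta> * \<delta>)"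
      using 3 by (simp add: field_simps)
    then have "(cmod (\<alpha> / \<beta> - \<gamma> / \<delta>))\<^sup>2 =
        (cmod (\<alpha> * \<delta> - \<beta> * \<gamma>))\<^sup>2 / ((cmod \<beta>)\<^sup>2 * (cmod \<delta>)\<^sup>2)"
      by (simp only: norm_divide norm_mult power_divide power_mult_distrib)
    moreover have "(cmod \<beta>)\<^sup>2 * (cmod \<delta>)\<^sup>2 \<noteq> 0" using 3 by simp
    ultimately show ?thesis
      unfolding sq by (simp only: divide_cancel_right) blast
  qed
qed

lemma tangent_horospheresI:
  assumes "cmod (\<alpha> * \<delta> - \<beta> * \<gamma>) = 1"
  shows "tangent (horosphere \<alpha> \<beta>) (horosphere \<gamma> \<delta>)"
proof -
  have "\<alpha> * \<delta> \<noteq> \<beta> * \<gamma>" using assms by auto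
  moreover from this have "\<alpha> \<noteq> 0 \<or> \<beta> \<noteq> 0" "\<gamma> \<noteq> 0 \<or> \<delta> \<noteq> 0" by auto
  ultimately show ?thesis using assms tangent_horospheres by blast
qed

text \<open>
  This is where internal contact is ruled out. If the sphere of \<open>(\<tau>, \<sigma>)\<close> had the base point of the
  first sphere, then \<open>(\<tau>, \<sigma>)\<close> would be a multiple of \<open>(\<alpha>, \<beta>)\<close>, and tangency to the second
  sphere would fix the modulus of the factor to be \<open>1\<close>, so that the two spheres would coincide.
\<close>

lemma tangent_to_tangent_pair:
  assumes "cmod (\<alpha> * \<delta> - \<beta> * \<gamma>) = 1" and nonzero: "\<tau> \<noteq> 0 \<or> \<sigma> \<noteq> 0"
    and tang: "tangent (horosphere \<tau> \<sigma>) (horosphere \<alpha> \<beta>)"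
      "tangent (horosphere \<tau> \<sigma>) (horosphere \<gamma> \<delta>)"
  shows "cmod (\<tau> * \<beta> - \<sigma> * \<alpha>) = 1"
proof -
  have ab: "\<alpha> \<noteq> 0 \<or> \<beta> \<noteq> 0" and gd: "\<gamma> \<noteq> 0 \<or> \<delta> \<noteq> 0" and D: "\<alpha> * \<delta> - \<beta> * \<gamma> \<noteq> 0"
    using assms(1) by auto
  have "\<tau> * \<beta> \<noteq> \<sigma> * \<alpha>"
  proof
    assume zero: "\<tau> * \<beta> = \<sigma> * \<alpha>"
    define E where "E = \<tau> * \<delta> - \<sigma> * \<gamma>"
    have "(\<alpha> * \<delta> - \<beta> * \<gamma>) * \<tau> = E * \<alpha> + (\<alpha> * \<sigma> - \<beta> * \<tau>) * \<gamma>"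
      "(\<alpha> * \<delta> - \<beta> * \<gamma>) * \<sigma> = E * \<beta> + (\<alpha> * \<sigma> - \<beta> * \<tau>) * \<delta>"
      by (simp_all add: E_def algebra_simps)
    moreover have "\<alpha> * \<sigma> - \<beta> * \<tau> = 0" using zero by (simp add: mult.commute)
    ultimately have eq: "\<tau> = E / (\<alpha> * \<delta> - \<beta> * \<gamma>) * \<alpha>" "\<sigma> = E / (\<alpha> * \<delta> - \<beta> * \<gamma>) * \<beta>"
      using D by (simp_all add: field_simps)
    then have "E \<noteq> 0" using nonzero by auto
    then have "cmod E = 1"
      using tangent_horospheres[OF nonzero gd] tang(2) by (auto simp: E_def)
    then have "cmod (E / (\<alpha> * \<delta> - \<beta> * \<gamma>)) = 1" using assms(1) by (simp add: norm_divide)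
    then have "horosphere \<tau> \<sigma> = horosphere \<alpha> \<beta>"
      using horosphere_rotate eq by metis
    then show False using tang(1) tangent_self by simp
  qed
  then show ?thesis using tangent_horospheres[OF nonzero ab] tang(1) by blast
qed

section \<open>The spheres of coprime pairs\<close>

lemma S_frac_horosphere:
  assumes "\<alpha> \<in> eisenstein" "eis_coprime \<alpha> \<beta>"
  shows "S_frac \<alpha> \<beta> = horosphere \<alpha> \<beta>"
proof (cases "\<beta> = 0")
  case True
  then have "eis_unit \<alpha>" using assms eis_coprime_0 by simp
  then show ?thesis using True eis_unit_cmod by (simp add: S_frac_def horosphere_def)
qed (simp add: S_frac_def horosphere_def)

lemma P_omega_horosphere:
  "P_omega = {horosphere \<alpha> \<beta> | \<alpha> \<beta>. \<alpha> \<in> eisenstein \<and> \<beta> \<in> eisenstein \<and> eis_coprime \<alpha> \<beta>}"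
  unfolding P_omega_def using S_frac_horosphere by metis

lemma eis_coprime_nonzero:
  assumes "eis_coprime \<alpha> \<beta>"
  shows "\<alpha> \<noteq> 0 \<or> \<beta> \<noteq> 0"
proof (rule ccontr)
  assume "\<not> (\<alpha> \<noteq> 0 \<or> \<beta> \<noteq> 0)"
  then have "eis_dvd 2 \<alpha> \<and> eis_dvd 2 \<beta>"
    unfolding eis_dvd_def by (auto intro: bexI[of _ 0])
  then have "eis_unit 2"
    using assms eisenstein_of_int[of 2] unfolding eis_coprime_def by simp
  then show False using eis_unit_cmod by fastforce
qed

text \<open>
  Two reduced fractions for the same base point differ by a unit.
\<close>

lemma coprime_same_horosphere:
  assumes "\<alpha> \<in> eisenstein" "\<beta> \<in> eisenstein" "eis_coprime \<alpha> \<beta>"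
    and "\<gamma> \<in> eisenstein" "\<delta> \<in> eisenstein" "eis_coprime \<gamma> \<delta>"
    and "\<alpha> * \<delta> = \<beta> * \<gamma>"
  shows "horosphere \<gamma> \<delta> = horosphere \<alpha> \<beta>"
proof -
  obtain x y where xy: "x \<in> eisenstein" "y \<in> eisenstein" "x * \<alpha> + y * \<beta> = 1"
    using eis_coprime_bezout assms(1-3) by blast
  define \<kappa> where "\<kappa> = x * \<gamma> + y * \<delta>"
  have \<kappa>: "\<kappa> \<in> eisenstein" using xy assms by (simp add: \<kappa>_def)
  have g: "\<gamma> = \<kappa> * \<alpha>"
  proof -
    have "\<kappa> * \<alpha> = \<gamma> * (x * \<alpha>) + y * (\<alpha> * \<delta>)" by (simp add: \<kappa>_def algebra_simps)
    also have "\<dots> = \<gamma> * (x * \<alpha> + y * \<beta>)" by (simp add: assms(7) algebra_simps)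
    finally show ?thesis using xy by simp
  qed
  have d: "\<delta> = \<kappa> * \<beta>"
  proof -
    have "\<kappa> * \<beta> = x * (\<beta> * \<gamma>) + \<delta> * (y * \<beta>)" by (simp add: \<kappa>_def algebra_simps)
    also have "\<dots> = \<delta> * (x * \<alpha> + y * \<beta>)" by (simp add: assms(7)[symmetric] algebra_simps)
    finally show ?thesis using xy by simp
  qed
  have "eis_unit \<kappa>"
    using assms(1,2,6) \<kappa> g d unfolding eis_coprime_def eis_dvd_def by blast
  then show ?thesis using g d horosphere_rotate[OF eis_unit_cmod] by simp
qed

lemma tangent_coprime_horospheres:
  assumes "\<alpha> \<in> eisenstein" "\<beta> \<in> eisenstein" "eis_coprime \<alpha> \<beta>"
    and "\<gamma> \<in> eisenstein" "\<delta> \<in> eisenstein" "eis_coprime \<gamma> \<delta>"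
    and "tangent (horosphere \<alpha> \<beta>) (horosphere \<gamma> \<delta>)"
  shows "cmod (\<alpha> * \<delta> - \<beta> * \<gamma>) = 1"
proof -
  have "\<alpha> * \<delta> \<noteq> \<beta> * \<gamma>"
    using coprime_same_horosphere[OF assms(1-6)] assms(7) tangent_self by metis
  then show ?thesis using tangent_horospheres assms(3,6,7) eis_coprime_nonzero by blast
qed

section \<open>Barycentric coordinates\<close>

text \<open>
  For \<open>n = 1\<close> this says that the entries of the Gram matrix of a coprime pair have no common factor.
  The multiplier \<open>n\<close> allows for comparing that matrix with a proportional one. The proof expands
  \<open>n = n * \<bar>x * \<alpha> + y * \<beta>\<bar>\<^sup>2\<close>; the mixed terms form a trace, which is an integer.
\<close>

lemma gram_common_factor:
  assumes "x \<in> eisenstein" "y \<in> eisenstein" "x * \<alpha> + y * \<beta> = 1" "\<xi> \<in> eisenstein"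
    and "of_int n * (cmod \<alpha>)\<^sup>2 = of_int (k * l)" "of_int n * (cmod \<beta>)\<^sup>2 = of_int (k * m)"
    and "of_int n * (\<alpha> * cnj \<beta>) = of_int k * \<xi>"
  shows "k dvd n"
proof -
  obtain p q :: int where pq: "(cmod x)\<^sup>2 = of_int p" "(cmod y)\<^sup>2 = of_int q"
    using assms(1,2) by (metis eisenstein_norm)
  obtain t where t: "x * cnj y * \<xi> + cnj (x * cnj y * \<xi>) = of_int t"
    using assms eisenstein_trace by (metis eisenstein_cnj eisenstein_mult)
  have sq: "of_int p = x * cnj x" "of_int q = y * cnj y"
    using pq complex_norm_square by (metis of_real_of_int_eq)+
  have a: "of_int n * (\<alpha> * cnj \<alpha>) = of_int (k * l)" 
    using assms(5) complex_norm_square[of \<alpha>] by (metis of_real_mult of_real_of_int_eq)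
  have b: "of_int n * (\<beta> * cnj \<beta>) = of_int (k * m)"
    using assms(6) complex_norm_square[of \<beta>] by (metis of_real_mult of_real_of_int_eq)
  have c: "of_int n * (cnj \<alpha> * \<beta>) = of_int k * cnj \<xi>"
    using arg_cong[OF assms(7), of cnj] by simp
  have "of_int n = of_int n * ((x * \<alpha> + y * \<beta>) * cnj (x * \<alpha> + y * \<beta>))"
    using assms(3) by simp
  also have "\<dots> = x * cnj x * (of_int n * (\<alpha> * cnj \<alpha>)) + y * cnj y * (of_int n * (\<beta> * cnj \<beta>))
      + x * cnj y * (of_int n * (\<alpha> * cnj \<beta>)) + cnj x * y * (of_int n * (cnj \<alpha> * \<beta>))"
    by (simp add: algebra_simps)
  also have "\<dots> = of_int p * of_int (k * l) + of_int q * of_int (k * m)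
      + of_int k * (x * cnj y * \<xi> + cnj (x * cnj y * \<xi>))"
    unfolding a b c assms(7) sq by (simp add: algebra_simps)
  also have "\<dots> = of_int (k * (p * l + q * m + t))"
    unfolding t by (simp add: algebra_simps)
  finally have "n = k * (p * l + q * m + t)" by (simp only: of_int_eq_iff)
  then show ?thesis by simp
qed

lemma eisenstein_lattice_coordinates:
  assumes "\<xi> \<in> eisenstein"
  obtains b c :: int where "\<xi> = of_int b + of_int c * (1 + omega)"
proof -
  obtain m n where "\<xi> = of_int m + of_int n * omega" using assms by (rule eisensteinE)
  then have "\<xi> = of_int (m - n) + of_int n * (1 + omega)" by (simp add: algebra_simps)
  with that show ?thesis by blast
qed

lemma lattice_norm:
  "(cmod (of_int b + of_int c * (1 + omega)))\<^sup>2 = of_int (b\<^sup>2 + b * c + c\<^sup>2)"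
proof -
  have "of_int b + of_int c * (1 + omega) = of_real (of_int (b + c)) + of_real (of_int c) * omega"
    by (simp add: algebra_simps)
  then show ?thesis
    by (simp only: cmod_omega_combination) (simp add: power2_eq_square algebra_simps)
qed

text \<open>
  Writing \<open>N = a + b + c\<close> and \<open>M = d + b + c\<close> turns the quadratic equation into
  \<open>M * N = \<bar>b + c * (1 + \<omega>)\<bar>\<^sup>2\<close>, the vanishing of a Hermitian determinant.
\<close>

lemma descartes_iff_det:
  fixes a b c d :: int
  shows "(a + b + c + d)\<^sup>2 = a\<^sup>2 + b\<^sup>2 + c\<^sup>2 + d\<^sup>2 \<longleftrightarrow>
    (d + b + c) * (a + b + c) = b\<^sup>2 + b * c + c\<^sup>2"
proof -
  have "(a + b + c + d)\<^sup>2 - (a\<^sup>2 + b\<^sup>2 + c\<^sup>2 + d\<^sup>2) =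
      2 * ((d + b + c) * (a + b + c) - (b\<^sup>2 + b * c + c\<^sup>2))"
    by (simp add: power2_eq_square algebra_simps)
  then show ?thesis by auto
qed

lemma S_bary_eq_S_frac:
  assumes "\<beta> \<noteq> 0" "of_int (a + b + c) = (cmod \<beta>)\<^sup>2"
    and "\<alpha> * cnj \<beta> = of_int b + of_int c * (1 + omega)"
  shows "S_bary (of_int a) (of_int b) (of_int c) = S_frac \<alpha> \<beta>"
proof -
  have N: "real_of_int a + of_int b + of_int c = (cmod \<beta>)\<^sup>2" using assms(2) by simp
  have "(of_real (of_int b) + of_real (of_int c) * (1 + omega)) / of_real ((cmod \<beta>)\<^sup>2) = \<alpha> / \<beta>"
    using assms(1) by (simp add: assms(3)[symmetric] complex_norm_square del: of_real_power)
  then show ?thesis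
    using assms(1) by (simp only: S_bary_def S_frac_def N if_False)
qed

lemma B_omega_subset_P_omega: "B_omega \<subseteq> P_omega"
proof
  fix A assume "A \<in> B_omega"
  then obtain a b c d :: int where A: "A = S_bary (of_int a) (of_int b) (of_int c)"
    and gcd: "Gcd {a, b, c, d} = 1"
    and eq: "(a + b + c + d)\<^sup>2 = a\<^sup>2 + b\<^sup>2 + c\<^sup>2 + d\<^sup>2" and pos: "a + b + c > 0"
    unfolding B_omega_def by blast
  define N M where "N = a + b + c" and "M = d + b + c"
  define \<xi> where "\<xi> = of_int b + of_int c * (1 + omega)"
  have \<xi>: "\<xi> \<in> eisenstein" by (simp add: \<xi>_def)
  have MN: "of_int (M * N) = (cmod \<xi>)\<^sup>2"
    using eq lattice_norm unfolding descartes_iff_det \<xi>_def M_def N_def by simp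
  \<comment> \<open>The base point \<open>\<xi> / N\<close> in lowest terms is \<open>\<alpha> / \<beta>\<close>.\<close>
  obtain x y where xy: "x \<in> eisenstein" "y \<in> eisenstein"
    and "eis_dvd (x * \<xi> + y * of_int N) \<xi>" "eis_dvd (x * \<xi> + y * of_int N) (of_int N)"
    using eisenstein_bezout[OF \<xi> eisenstein_of_int[of N]] by blast
  then obtain g \<alpha> \<beta> where g: "g = x * \<xi> + y * of_int N"
    and ab: "\<alpha> \<in> eisenstein" "\<beta> \<in> eisenstein" "\<xi> = g * \<alpha>" "of_int N = g * \<beta>"
    unfolding eis_dvd_def by blast
  have N0: "N > 0" using pos by (simp add: N_def)
  have "g * \<beta> \<noteq> 0" using N0 ab(4) by (metis less_irrefl of_int_eq_0_iff)
  then have g0: "g \<noteq> 0" and \<beta>0: "\<beta> \<noteq> 0" by auto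
  have "g * (x * \<alpha> + y * \<beta>) = g * 1" using g unfolding ab(3,4) by (simp add: algebra_simps)
  then have bez: "x * \<alpha> + y * \<beta> = 1" using g0 by simp
  then have cop: "eis_coprime \<alpha> \<beta>"
    by (intro bezout_eis_coprime[OF xy]) (simp add: cmod_1_eis_unit)
  obtain K L :: int where K: "(cmod \<beta>)\<^sup>2 = of_int K" "K \<ge> 0" and L: "(cmod \<alpha>)\<^sup>2 = of_int L"
    using ab by (metis eisenstein_norm)
  obtain b' c' :: int where bc': "\<alpha> * cnj \<beta> = of_int b' + of_int c' * (1 + omega)"
    using ab eisenstein_lattice_coordinates by (metis eisenstein_cnj eisenstein_mult)
  have bb: "of_int K = \<beta> * cnj \<beta>" using K complex_norm_square by (metis of_real_of_int_eq)
  \<comment> \<open>The Gram matrix of \<open>\<alpha>, \<beta>\<close>, multiplied by \<open>N\<close>, is the matrix of \<open>M, N, \<xi>\<close>, multiplied by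
    \<open>K\<close>. Each of the two being primitive, \<open>K\<close> and \<open>N\<close> divide each other.\<close>
  have cone: "of_int N * (\<alpha> * cnj \<beta>) = of_int K * \<xi>"
    unfolding ab(3,4) bb by (simp add: algebra_simps)
  have NL: "N * L = K * M"
  proof -
    have "(real_of_int N)\<^sup>2 * of_int L = (cmod (g * \<beta>))\<^sup>2 * (cmod \<alpha>)\<^sup>2"
      by (simp add: ab(4)[symmetric] L)
    also have "\<dots> = of_int K * of_int (M * N)"
      unfolding MN ab(3) K(1)[symmetric] by (simp add: norm_mult power_mult_distrib)
    finally have "N\<^sup>2 * L = K * (M * N)" by (metis of_int_eq_iff of_int_mult of_int_power)
    then have "N * (N * L) = N * (K * M)" by (simp add: power2_eq_square algebra_simps)
    then show ?thesis using N0 by simp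
  qed
  have "K dvd N"
    using gram_common_factor[OF xy bez \<xi> _ _ cone, of M N] NL L K
    by (simp add: algebra_simps flip: of_int_mult)
  moreover have "N dvd K"
  proof -
    have "of_int (N * b') + of_int (N * c') * (1 + omega)
        = of_int (K * b) + of_int (K * c) * (1 + omega)"
      using cone unfolding bc' \<xi>_def by (simp add: algebra_simps)
    then have "N * c' = K * c" "N * b' = K * b"
      by (auto simp: complex_eq_iff omega_Re_Im simp flip: of_int_mult)
    then have "N dvd K * b" "N dvd K * c" by (metis dvd_triv_left)+
    moreover have "N dvd K * N" "N dvd K * M" using NL by (metis dvd_triv_left dvd_triv_right)+
    moreover have "K * a = K * N - K * b - K * c" "K * d = K * M - K * b - K * c"
      by (simp_all add: N_def M_def algebra_simps)
    ultimately have "N dvd K * a" "N dvd K * b" "N dvd K * c" "N dvd K * d"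
      by (metis dvd_diff)+
    then have "N dvd gcd (K * a) (gcd (K * b) (gcd (K * c) (K * d)))" by simp
    also have "gcd (K * a) (gcd (K * b) (gcd (K * c) (K * d))) = K * gcd a (gcd b (gcd c d))"
      using K(2) by (simp add: gcd_mult_distrib_int[symmetric])
    finally have "N dvd K * gcd a (gcd b (gcd c d))" .
    then show ?thesis using gcd by simp
  qed
  ultimately have "K = N" using K(2) N0 by (simp add: zdvd_antisym_nonneg)
  with cone have "\<alpha> * cnj \<beta> = \<xi>" using N0 by simp
  then have "A = S_frac \<alpha> \<beta>"
    unfolding A \<xi>_def using \<beta>0 K \<open>K = N\<close> by (intro S_bary_eq_S_frac) (auto simp: N_def)
  then show "A \<in> P_omega" using ab cop unfolding P_omega_def by blast
qed

lemma P_omega_subset_B_omega: "P_omega \<subseteq> B_omega \<union> {S_frac 1 0}"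
proof
  fix A assume "A \<in> P_omega"
  then obtain \<alpha> \<beta> where A: "A = S_frac \<alpha> \<beta>" and ab: "\<alpha> \<in> eisenstein" "\<beta> \<in> eisenstein"
    and cop: "eis_coprime \<alpha> \<beta>"
    unfolding P_omega_def by blast
  show "A \<in> B_omega \<union> {S_frac 1 0}"
  proof (cases "\<beta> = 0")
    case True
    then show ?thesis using A by (simp add: S_frac_def)
  next
    case False
    obtain x y where xy: "x \<in> eisenstein" "y \<in> eisenstein" "x * \<alpha> + y * \<beta> = 1"
      using eis_coprime_bezout ab cop by blast
    obtain N M :: int where N: "(cmod \<beta>)\<^sup>2 = of_int N" and M: "(cmod \<alpha>)\<^sup>2 = of_int M"
      using ab by (metis eisenstein_norm)
    have "real_of_int N > 0" unfolding N[symmetric] using False by simp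
    then have N0: "N > 0" by simp
    obtain b c where bc: "\<alpha> * cnj \<beta> = of_int b + of_int c * (1 + omega)"
      using ab eisenstein_lattice_coordinates by (metis eisenstein_cnj eisenstein_mult)
    define a d where "a = N - b - c" and "d = M - b - c"
    have "real_of_int (M * N) = (cmod (\<alpha> * cnj \<beta>))\<^sup>2"
      by (simp add: norm_mult power_mult_distrib M N)
    then have "M * N = b\<^sup>2 + b * c + c\<^sup>2"
      unfolding bc lattice_norm by (simp only: of_int_eq_iff)
    then have eq: "(a + b + c + d)\<^sup>2 = a\<^sup>2 + b\<^sup>2 + c\<^sup>2 + d\<^sup>2"
      unfolding descartes_iff_det by (simp add: a_def d_def)
    define k where "k = Gcd {a, b, c, d}"
    have k: "k dvd a" "k dvd b" "k dvd c" "k dvd d"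
      unfolding k_def by (rule Gcd_dvd; simp)+
    have "N = a + b + c" "M = d + b + c" by (simp_all add: a_def d_def)
    then have "k dvd N" "k dvd M" using k by simp_all
    then obtain n m b' c' where *: "N = k * n" "M = k * m" "b = k * b'" "c = k * c'"
      using k(2,3) by (meson dvdE)
    have "k dvd 1"
    proof (rule gram_common_factor[OF xy, of "of_int b' + of_int c' * (1 + omega)" 1 k m n])
      show "of_int 1 * (\<alpha> * cnj \<beta>) = of_int k * (of_int b' + of_int c' * (1 + omega))"
        using bc * by (simp add: algebra_simps)
    qed (use M N * in simp_all)
    moreover have "k \<ge> 0" by (simp add: k_def)
    ultimately have "Gcd {a, b, c, d} = 1" unfolding k_def by (simp only: zdvd1_eq)
    moreover have "a + b + c > 0" using N0 by (simp add: a_def)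
    moreover have "A = S_bary (of_int a) (of_int b) (of_int c)"
      unfolding A using False bc N by (intro S_bary_eq_S_frac[symmetric]) (auto simp: a_def)
    ultimately show ?thesis using eq unfolding B_omega_def by blast
  qed
qed

section \<open>The tetrahedral procedure stays among coprime pairs\<close>

text \<open>
  The points \<open>0\<close>, \<open>1\<close> and \<open>\<eta>\<close> form an equilateral triangle with side \<open>1\<close>.
\<close>

lemma unit_triangle:
  assumes "cmod \<eta> = 1" "cmod (1 - \<eta>) = 1"
  shows "\<eta> = 1 + omega \<or> \<eta> = - omega"
proof -
  have 1: "(Re \<eta>)\<^sup>2 + (Im \<eta>)\<^sup>2 = 1" and 2: "(1 - Re \<eta>)\<^sup>2 + (Im \<eta>)\<^sup>2 = 1"
    using assms by (metis cmod_power2 power_one, metis cmod_power2 power_one minus_complex.sel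
        one_complex.sel diff_0 power2_minus)
  then have re: "Re \<eta> = 1 / 2" by (simp add: power2_eq_square algebra_simps)
  then have "(Im \<eta>)\<^sup>2 = (sqrt 3 / 2)\<^sup>2" using 1 unfolding re by (simp add: power_divide)
  then have "Im \<eta> = sqrt 3 / 2 \<or> Im \<eta> = - (sqrt 3 / 2)" by (simp only: power2_eq_iff)
  then show ?thesis using re by (auto simp: complex_eq_iff omega_Re_Im)
qed

text \<open>
  Write \<open>w = p * u + q * v\<close> and \<open>t = x * u + y * v\<close>, where \<open>u = (\<alpha>, \<beta>)\<close> and \<open>v = (\<gamma>, \<delta>)\<close>. Tangency to
  \<open>u\<close> and \<open>v\<close> gives all four coordinates modulus \<open>1\<close>, and tangency of \<open>t\<close> and \<open>w\<close> gives
  \<open>\<bar>x * q - y * p\<bar> = 1\<close>. So \<open>\<eta> = (y * p) / (x * q)\<close> is the apex of an equilateral triangle on \<open>[0, 1]\<close>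
  and \<open>y / x\<close> is an Eisenstein unit. Dividing \<open>t\<close> by the phase \<open>x\<close> makes it an Eisenstein vector,
  which is coprime because it forms with \<open>v\<close> a matrix of unit determinant.
\<close>

lemma fourth_horosphere:
  assumes eis: "\<alpha> \<in> eisenstein" "\<beta> \<in> eisenstein" "\<gamma> \<in> eisenstein" "\<delta> \<in> eisenstein"
      "\<epsilon> \<in> eisenstein" "\<zeta> \<in> eisenstein"
    and D: "cmod (\<alpha> * \<delta> - \<beta> * \<gamma>) = 1"
    and w: "cmod (\<epsilon> * \<beta> - \<zeta> * \<alpha>) = 1" "cmod (\<epsilon> * \<delta> - \<zeta> * \<gamma>) = 1"
    and t: "cmod (\<tau> * \<beta> - \<sigma> * \<alpha>) = 1" "cmod (\<tau> * \<delta> - \<sigma> * \<gamma>) = 1"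
      "cmod (\<tau> * \<zeta> - \<sigma> * \<epsilon>) = 1"
  obtains \<tau>' \<sigma>' where "\<tau>' \<in> eisenstein" "\<sigma>' \<in> eisenstein" "eis_coprime \<tau>' \<sigma>'"
    "horosphere \<tau>' \<sigma>' = horosphere \<tau> \<sigma>"
proof -
  define d where "d = \<alpha> * \<delta> - \<beta> * \<gamma>"
  \<comment> \<open>Cramer's rule without its denominator \<open>d\<close>: the coordinates of the third vector are
    \<open>p / d, q / d\<close> and those of the fourth \<open>x / d, y / d\<close>.\<close>
  define p q x y where "p = \<epsilon> * \<delta> - \<zeta> * \<gamma>" and "q = \<alpha> * \<zeta> - \<beta> * \<epsilon>"
    and "x = \<tau> * \<delta> - \<sigma> * \<gamma>" and "y = \<alpha> * \<sigma> - \<beta> * \<tau>"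
  have pq: "p \<in> eisenstein" "q \<in> eisenstein" using eis by (simp_all add: p_def q_def)
  have "cmod (- q) = 1" "cmod (- y) = 1"
    using w t by (simp_all only: q_def y_def minus_diff_eq mult.commute)
  then have mods: "cmod d = 1" "cmod p = 1" "cmod q = 1" "cmod x = 1" "cmod y = 1"
    using D w t by (simp_all add: d_def p_def x_def)
  then have nz: "d \<noteq> 0" "p \<noteq> 0" "q \<noteq> 0" "x \<noteq> 0" "y \<noteq> 0" by auto
  have "x * q - y * p = d * (\<tau> * \<zeta> - \<sigma> * \<epsilon>)"
    by (simp add: x_def y_def p_def q_def d_def algebra_simps)
  then have xqyp: "cmod (x * q - y * p) = 1" using t mods by (simp add: norm_mult)
  define \<eta> where "\<eta> = (y * p) / (x * q)"
  have "1 - \<eta> = (x * q - y * p) / (x * q)" using nz by (simp add: \<eta>_def field_simps)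
  then have "cmod (1 - \<eta>) = 1" using xqyp mods by (simp add: norm_divide norm_mult)
  moreover have "cmod \<eta> = 1" using mods by (simp add: \<eta>_def norm_divide norm_mult)
  ultimately have "\<eta> = 1 + omega \<or> \<eta> = - omega" by (intro unit_triangle)
  then have \<eta>: "\<eta> \<in> eisenstein" by auto
  define \<mu> where "\<mu> = \<eta> * q * cnj p"
  have \<mu>: "\<mu> \<in> eisenstein" using \<eta> pq by (simp add: \<mu>_def)
  have "p * cnj p = 1" using mods by (simp add: complex_norm_square[symmetric])
  then have "x * \<mu> * p = y * p" using nz by (simp add: \<mu>_def \<eta>_def field_simps)
  then have y: "y = x * \<mu>" using nz by simp
  have "d * \<tau> = x * \<alpha> + y * \<gamma>" "d * \<sigma> = x * \<beta> + y * \<delta>"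
    by (simp_all add: d_def x_def y_def algebra_simps)
  then have \<tau>: "\<tau> = x / d * (\<alpha> + \<mu> * \<gamma>)" "\<sigma> = x / d * (\<beta> + \<mu> * \<delta>)"
    using nz by (simp_all add: y field_simps)
  have "cmod (x / d) = 1" using mods by (simp add: norm_divide)
  then have "horosphere (\<alpha> + \<mu> * \<gamma>) (\<beta> + \<mu> * \<delta>) = horosphere \<tau> \<sigma>"
    unfolding \<tau> by (rule horosphere_rotate[symmetric])
  moreover have "eis_coprime (\<alpha> + \<mu> * \<gamma>) (\<beta> + \<mu> * \<delta>)"
  proof (rule bezout_eis_coprime[of \<delta> "- \<gamma>"])
    have "\<delta> * (\<alpha> + \<mu> * \<gamma>) + - \<gamma> * (\<beta> + \<mu> * \<delta>) = d" by (simp add: d_def algebra_simps)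
    moreover have "d \<in> eisenstein" using eis by (simp add: d_def)
    ultimately show "eis_unit (\<delta> * (\<alpha> + \<mu> * \<gamma>) + - \<gamma> * (\<beta> + \<mu> * \<delta>))"
      using mods cmod_1_eis_unit by simp
  qed (use eis in simp_all)
  ultimately show ?thesis
    using that[of "\<alpha> + \<mu> * \<gamma>" "\<beta> + \<mu> * \<delta>"] eis \<mu> eisenstein_add eisenstein_mult by blast
qed

lemma tetra_step_P_omega:
  assumes "\<S> \<subseteq> P_omega" "tetra_step \<S> \<S>'"
  shows "\<S>' \<subseteq> P_omega"
proof -
  obtain A B C where ABC: "A \<in> P_omega" "B \<in> P_omega" "C \<in> P_omega"
    and tang: "tangent A B" "tangent A C" "tangent B C"
    and \<S>': "\<S>' = \<S> \<union> {T. normal_sphere T \<and> tangent T A \<and> tangent T B \<and> tangent T C}"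
    using assms unfolding tetra_step_def by blast
  from ABC obtain \<alpha> \<beta> \<gamma> \<delta> \<epsilon> \<zeta> where
    A: "A = horosphere \<alpha> \<beta>" "\<alpha> \<in> eisenstein" "\<beta> \<in> eisenstein" "eis_coprime \<alpha> \<beta>" and
    B: "B = horosphere \<gamma> \<delta>" "\<gamma> \<in> eisenstein" "\<delta> \<in> eisenstein" "eis_coprime \<gamma> \<delta>" and
    C: "C = horosphere \<epsilon> \<zeta>" "\<epsilon> \<in> eisenstein" "\<zeta> \<in> eisenstein" "eis_coprime \<epsilon> \<zeta>"
    unfolding P_omega_horosphere by blast
  note AB = tangent_coprime_horospheres[OF A(2-4) B(2-4) tang(1)[unfolded A(1) B(1)]]
  note BA = tangent_coprime_horospheres[OF B(2-4) A(2-4)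
      tang(1)[unfolded A(1) B(1), THEN tangent_commute[THEN iffD1]]]
  note CA = tangent_coprime_horospheres[OF C(2-4) A(2-4)
      tang(2)[unfolded A(1) C(1), THEN tangent_commute[THEN iffD1]]]
  note CB = tangent_coprime_horospheres[OF C(2-4) B(2-4)
      tang(3)[unfolded B(1) C(1), THEN tangent_commute[THEN iffD1]]]
  have "T \<in> P_omega" if T: "normal_sphere T" "tangent T A" "tangent T B" "tangent T C" for T
  proof -
    obtain \<tau> \<sigma> where nonzero: "\<tau> \<noteq> 0 \<or> \<sigma> \<noteq> 0" and eq: "T = horosphere \<tau> \<sigma>"
      using T(1) normal_sphere_iff_horosphere by blast
    note tT = T(2-4)[unfolded A(1) B(1) C(1) eq]
    obtain \<tau>' \<sigma>' where "\<tau>' \<in> eisenstein" "\<sigma>' \<in> eisenstein" "eis_coprime \<tau>' \<sigma>'"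
      "horosphere \<tau>' \<sigma>' = horosphere \<tau> \<sigma>"
      using fourth_horosphere[OF A(2,3) B(2,3) C(2,3) AB CA CB
          tangent_to_tangent_pair[OF AB nonzero tT(1,2)]
          tangent_to_tangent_pair[OF BA nonzero tT(2,1)]
          tangent_to_tangent_pair[OF CA nonzero tT(3,1)]] by blast
    then show ?thesis unfolding P_omega_horosphere eq by blast
  qed
  then show ?thesis using assms(1) \<S>' by blast
qed

lemma eis_coprime_1: "eis_coprime \<alpha> 1"
  by (rule bezout_eis_coprime[of 0 1]) (simp_all add: cmod_1_eis_unit)

lemma tetra_start_subset_P_omega: "tetra_start \<subseteq> P_omega"
proof -
  have "S_frac \<alpha> 1 \<in> P_omega" if "\<alpha> \<in> eisenstein" for \<alpha>
    using that eis_coprime_1 eisenstein_1 unfolding P_omega_def by blast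
  then show ?thesis by (simp add: tetra_start_def)
qed

lemma G_omega_subset_P_omega: "G_omega \<subseteq> P_omega"
proof -
  have "\<S> n \<subseteq> P_omega" if "tetra_chain \<S>" for \<S> n
  proof (induction n)
    case 0
    then show ?case using that tetra_start_subset_P_omega by (simp add: tetra_chain_def)
  next
    case (Suc n)
    then show ?case using that tetra_step_P_omega unfolding tetra_chain_def by blast
  qed
  then show ?thesis unfolding G_omega_def by blast
qed

section \<open>The tetrahedral procedure reaches every coprime pair\<close>

lemma tetra_start_horospheres:
  "tetra_start = {horosphere 0 1, horosphere 1 1, horosphere (1 + omega) 1}"
  by (simp add: tetra_start_def S_frac_def horosphere_def)

lemma cmod_omega: "cmod omega = 1" "cmod (1 + omega) = 1" "cmod (- 1 - omega) = 1"
  by (simp_all add: cmod_def omega_Re_Im power_divide)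

lemma tetra_start_tangent:
  "tangent (horosphere 0 1) (horosphere 1 1)"
  "tangent (horosphere 0 1) (horosphere (1 + omega) 1)"
  "tangent (horosphere 1 1) (horosphere (1 + omega) 1)"
  using cmod_omega by (auto intro!: tangent_horospheresI simp: add.commute[of omega])

lemma reachable_subset_G_omega:
  assumes "tetra_step\<^sup>*\<^sup>* tetra_start \<S>"
  shows "\<S> \<subseteq> G_omega"
proof -
  obtain n where "(tetra_step ^^ n) tetra_start \<S>" using assms by (metis rtranclp_imp_relpowp)
  then obtain f where f: "f 0 = tetra_start" "f n = \<S>" "\<forall>i<n. tetra_step (f i) (f (Suc i))"
    by (metis relpowp_fun_conv)
  have "tetra_start \<subseteq> \<S>"
    using assms
  proof (induction rule: rtranclp_induct)
    case (step X Y)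
    then show ?case unfolding tetra_step_def by blast
  qed simp
  \<comment> \<open>Chains are infinite, so the finite one is continued by choosing the initial triple for ever.\<close>
  define N where "N = {T. normal_sphere T \<and> tangent T (horosphere 0 1)
    \<and> tangent T (horosphere 1 1) \<and> tangent T (horosphere (1 + omega) 1)}"
  have rep: "tetra_step X (X \<union> N)" if "tetra_start \<subseteq> X" for X
  proof -
    have "horosphere 0 1 \<in> X" "horosphere 1 1 \<in> X" "horosphere (1 + omega) 1 \<in> X"
      using that tetra_start_horospheres by auto
    then show ?thesis using tetra_start_tangent unfolding tetra_step_def N_def by blast
  qed
  define g where "g i = (if i \<le> n then f i else \<S> \<union> N)" for i
  have "tetra_step (g i) (g (Suc i))" for i
  proof -
    consider "i < n" | "i = n" | "i > n" by linarith
    then show ?thesis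
    proof cases
      case 1
      then show ?thesis using f by (simp add: g_def)
    next
      case 2
      then show ?thesis using f rep \<open>tetra_start \<subseteq> \<S>\<close> by (simp add: g_def)
    next
      case 3
      have "tetra_step (\<S> \<union> N) (\<S> \<union> N \<union> N)" using rep \<open>tetra_start \<subseteq> \<S>\<close> by blast
      then show ?thesis using 3 by (simp add: g_def Un_assoc)
    qed
  qed
  then have "tetra_chain g" using f by (simp add: tetra_chain_def g_def)
  then have "g n \<subseteq> G_omega" unfolding G_omega_def by blast
  then show ?thesis using f by (simp add: g_def)
qed

text \<open>
  The powers of \<open>1 + \<omega>\<close>, a primitive sixth root of unity, are the units of \<open>\<int>[\<omega>]\<close>.
\<close>

lemma zeta_powers:
  "(1 + omega) ^ 2 = omega" "(1 + omega) ^ 3 = - 1" "(1 + omega) ^ 5 = - omega"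
  "(1 + omega) ^ 6 = 1"
proof -
  show 2: "(1 + omega) ^ 2 = omega"
    by (simp add: power2_eq_square algebra_simps omega_square)
  have "(1 + omega) ^ 3 = (1 + omega) ^ 2 * (1 + omega)" by (simp add: eval_nat_numeral)
  then show 3: "(1 + omega) ^ 3 = - 1" unfolding 2 by (simp add: algebra_simps omega_square)
  have "(1 + omega) ^ 5 = (1 + omega) ^ 2 * (1 + omega) ^ 3" by (simp flip: power_add)
  then show "(1 + omega) ^ 5 = - omega" unfolding 2 3 by simp
  have "(1 + omega) ^ 6 = (1 + omega) ^ 3 * (1 + omega) ^ 3" by (simp flip: power_add)
  then show "(1 + omega) ^ 6 = 1" unfolding 3 by simp
qed

lemma zeta_power_period: "(1 + omega) ^ (m + 6 * k) = (1 + omega) ^ m"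
  by (simp add: power_add power_mult zeta_powers)

lemma cmod_zeta_power: "cmod ((1 + omega) ^ k) = 1"
  by (simp add: norm_power cmod_omega)

text \<open>
  The third sphere is what allows a step to be taken from \<open>u = (\<alpha>, \<beta>)\<close> and \<open>v = (\<gamma>, \<delta>)\<close>. Which of the six
  neighbours \<open>u + \<zeta>\<^sup>k * v\<close> it is remains open, so that the relation is preserved by the moves of
  Euclid's algorithm.
\<close>

definition linked :: "complex \<Rightarrow> complex \<Rightarrow> complex \<Rightarrow> complex \<Rightarrow> bool" where
  "linked \<alpha> \<beta> \<gamma> \<delta> \<longleftrightarrow> cmod (\<alpha> * \<delta> - \<beta> * \<gamma>) = 1 \<and>
    (\<exists>\<S> k. tetra_step\<^sup>*\<^sup>* tetra_start \<S> \<and> {horosphere \<alpha> \<beta>, horosphere \<gamma> \<delta>,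
      horosphere (\<alpha> + (1 + omega) ^ k * \<gamma>) (\<beta> + (1 + omega) ^ k * \<delta>)} \<subseteq> \<S>)"

text \<open>
  Put \<open>\<zeta> = 1 + \<omega>\<close>, \<open>u = (\<alpha>, \<beta>)\<close> and \<open>v = (\<gamma>, \<delta>)\<close>, and call \<open>u + \<zeta>\<^sup>k * v\<close> the neighbours of \<open>u, v\<close>.
  Consecutive neighbours are tangent, because \<open>\<zeta> - 1 = \<omega>\<close> is a unit and their determinant is that
  of \<open>u, v\<close> multiplied by \<open>\<zeta>\<^sup>k * (1 - \<zeta>)\<close>. So the step that chooses \<open>u\<close>, \<open>v\<close> and one neighbour adds the next.
\<close>

lemma next_neighbour_reachable:
  assumes D: "cmod (\<alpha> * \<delta> - \<beta> * \<gamma>) = 1" and reach: "tetra_step\<^sup>*\<^sup>* tetra_start \<S>"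
    and sub: "{horosphere \<alpha> \<beta>, horosphere \<gamma> \<delta>,
      horosphere (\<alpha> + (1 + omega) ^ k * \<gamma>) (\<beta> + (1 + omega) ^ k * \<delta>)} \<subseteq> \<S>"
  obtains \<S>' where "tetra_step\<^sup>*\<^sup>* tetra_start \<S>'" "{horosphere \<alpha> \<beta>, horosphere \<gamma> \<delta>,
      horosphere (\<alpha> + (1 + omega) ^ Suc k * \<gamma>) (\<beta> + (1 + omega) ^ Suc k * \<delta>)} \<subseteq> \<S>'"
proof -
  define e where "e = (1 + omega) ^ k"
  define f where "f = (1 + omega) ^ Suc k"
  have mods: "cmod e = 1" "cmod f = 1" by (simp_all only: e_def f_def cmod_zeta_power)
  have fe: "f = e + omega * e" by (simp add: e_def f_def algebra_simps)
  have 1: "tangent (horosphere \<alpha> \<beta>) (horosphere \<gamma> \<delta>)"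
    using D by (rule tangent_horospheresI)
  have u: "tangent (horosphere (\<alpha> + x * \<gamma>) (\<beta> + x * \<delta>)) (horosphere \<alpha> \<beta>)" if "cmod x = 1" for x
  proof (rule tangent_horospheresI)
    have "(\<alpha> + x * \<gamma>) * \<beta> - (\<beta> + x * \<delta>) * \<alpha> = - (x * (\<alpha> * \<delta> - \<beta> * \<gamma>))"
      by (simp add: algebra_simps)
    then show "cmod ((\<alpha> + x * \<gamma>) * \<beta> - (\<beta> + x * \<delta>) * \<alpha>) = 1"
      using D that by (simp only: norm_minus_cancel norm_mult mult_1)
  qed
  have v: "tangent (horosphere (\<alpha> + x * \<gamma>) (\<beta> + x * \<delta>)) (horosphere \<gamma> \<delta>)" for x
  proof (rule tangent_horospheresI)
    have "(\<alpha> + x * \<gamma>) * \<delta> - (\<beta> + x * \<delta>) * \<gamma> = \<alpha> * \<delta> - \<beta> * \<gamma>"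
      by (simp add: algebra_simps)
    then show "cmod ((\<alpha> + x * \<gamma>) * \<delta> - (\<beta> + x * \<delta>) * \<gamma>) = 1" using D by simp
  qed
  have w: "tangent (horosphere (\<alpha> + f * \<gamma>) (\<beta> + f * \<delta>)) (horosphere (\<alpha> + e * \<gamma>) (\<beta> + e * \<delta>))"
  proof (rule tangent_horospheresI)
    have "(\<alpha> + f * \<gamma>) * (\<beta> + e * \<delta>) - (\<beta> + f * \<delta>) * (\<alpha> + e * \<gamma>) =
        - (omega * e * (\<alpha> * \<delta> - \<beta> * \<gamma>))"
      by (simp add: fe algebra_simps)
    then show "cmod ((\<alpha> + f * \<gamma>) * (\<beta> + e * \<delta>) - (\<beta> + f * \<delta>) * (\<alpha> + e * \<gamma>)) = 1"
      using D mods cmod_omega by (simp only: norm_minus_cancel norm_mult mult_1)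
  qed
  have nrm: "normal_sphere (horosphere (\<alpha> + f * \<gamma>) (\<beta> + f * \<delta>))"
  proof -
    have "\<alpha> + f * \<gamma> \<noteq> 0 \<or> \<beta> + f * \<delta> \<noteq> 0"
    proof (rule ccontr)
      assume "\<not> ?thesis"
      moreover have "(\<alpha> + f * \<gamma>) * \<delta> - (\<beta> + f * \<delta>) * \<gamma> = \<alpha> * \<delta> - \<beta> * \<gamma>"
        by (simp add: algebra_simps)
      ultimately show False using D by simp
    qed
    then show ?thesis using normal_sphere_iff_horosphere by blast
  qed
  let ?A = "horosphere \<alpha> \<beta>" and ?B = "horosphere \<gamma> \<delta>"
    and ?C = "horosphere (\<alpha> + e * \<gamma>) (\<beta> + e * \<delta>)"
    and ?T = "horosphere (\<alpha> + f * \<gamma>) (\<beta> + f * \<delta>)"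
  define \<S>' where "\<S>' = \<S> \<union> {T. normal_sphere T \<and> tangent T ?A \<and> tangent T ?B \<and> tangent T ?C}"
  have "?A \<in> \<S>" "?B \<in> \<S>" "?C \<in> \<S>" using sub by (auto simp: e_def)
  moreover have "tangent ?A ?C" "tangent ?B ?C"
    using u[OF mods(1)] v by (simp_all add: tangent_commute)
  ultimately have "tetra_step \<S> \<S>'"
    using 1 unfolding tetra_step_def \<S>'_def by blast
  then have "tetra_step\<^sup>*\<^sup>* tetra_start \<S>'" using reach by simp
  moreover have "{?A, ?B, ?T} \<subseteq> \<S>'"
    using sub nrm u[OF mods(2)] v w unfolding \<S>'_def by blast
  ultimately show ?thesis using that unfolding f_def by blast
qed

text \<open>
  Going round the six neighbours one by one, \<open>m + 5 * k\<close> steps lead from the exponent \<open>k\<close> to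
  \<open>m + 6 * k\<close>, which stands for the same neighbour as \<open>m\<close>.
\<close>

lemma linked_all_neighbours:
  assumes "linked \<alpha> \<beta> \<gamma> \<delta>"
  obtains \<S> where "tetra_step\<^sup>*\<^sup>* tetra_start \<S>" "horosphere \<alpha> \<beta> \<in> \<S>" "horosphere \<gamma> \<delta> \<in> \<S>"
    "horosphere (\<alpha> + (1 + omega) ^ m * \<gamma>) (\<beta> + (1 + omega) ^ m * \<delta>) \<in> \<S>"
proof -
  obtain \<S> k where D: "cmod (\<alpha> * \<delta> - \<beta> * \<gamma>) = 1" and reach: "tetra_step\<^sup>*\<^sup>* tetra_start \<S>"
    and sub: "{horosphere \<alpha> \<beta>, horosphere \<gamma> \<delta>,
      horosphere (\<alpha> + (1 + omega) ^ k * \<gamma>) (\<beta> + (1 + omega) ^ k * \<delta>)} \<subseteq> \<S>"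
    using assms unfolding linked_def by blast
  have "\<exists>\<S>. tetra_step\<^sup>*\<^sup>* tetra_start \<S> \<and> {horosphere \<alpha> \<beta>, horosphere \<gamma> \<delta>,
      horosphere (\<alpha> + (1 + omega) ^ (k + n) * \<gamma>) (\<beta> + (1 + omega) ^ (k + n) * \<delta>)} \<subseteq> \<S>" for n
  proof (induction n)
    case 0
    then show ?case using reach sub by (metis add_0_right)
  next
    case (Suc n)
    then show ?case using next_neighbour_reachable[OF D] by (metis add_Suc_right)
  qed
  from this[of "m + 5 * k"] obtain \<S>' where "tetra_step\<^sup>*\<^sup>* tetra_start \<S>'"
    "{horosphere \<alpha> \<beta>, horosphere \<gamma> \<delta>, horosphere (\<alpha> + (1 + omega) ^ (m + 6 * k) * \<gamma>)
      (\<beta> + (1 + omega) ^ (m + 6 * k) * \<delta>)} \<subseteq> \<S>'"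
    by (auto simp: algebra_simps)
  then show ?thesis using that unfolding zeta_power_period by blast
qed

text \<open>
  The neighbours of \<open>v, u\<close> are those of \<open>u, v\<close>, since \<open>v + \<zeta>\<^sup>k * u\<close> is \<open>\<zeta>\<^sup>k * (u + \<zeta>\<^sup>-\<^sup>k * v)\<close>; the exponent
  \<open>5 * k\<close> stands for \<open>-k\<close>.
\<close>

lemma neighbour_rotate:
  "horosphere (\<gamma> + (1 + omega) ^ k * \<alpha>) (\<delta> + (1 + omega) ^ k * \<beta>) =
    horosphere (\<alpha> + (1 + omega) ^ (5 * k) * \<gamma>) (\<beta> + (1 + omega) ^ (5 * k) * \<delta>)"
proof -
  have *: "(1 + omega) ^ k * (1 + omega) ^ (5 * k) = 1"
    using zeta_power_period[of 0 k] by (simp flip: power_add)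
  have "\<gamma> + (1 + omega) ^ k * \<alpha> = (1 + omega) ^ k * (\<alpha> + (1 + omega) ^ (5 * k) * \<gamma>)"
    "\<delta> + (1 + omega) ^ k * \<beta> = (1 + omega) ^ k * (\<beta> + (1 + omega) ^ (5 * k) * \<delta>)"
    using * by (simp_all only: distrib_left mult.assoc[symmetric] mult_1 add.commute)
  then show ?thesis using horosphere_rotate[OF cmod_zeta_power] by presburger
qed

lemma linked_swap:
  assumes "linked \<alpha> \<beta> \<gamma> \<delta>"
  shows "linked \<gamma> \<delta> \<alpha> \<beta>"
proof -
  obtain \<S> where "tetra_step\<^sup>*\<^sup>* tetra_start \<S>" "horosphere \<alpha> \<beta> \<in> \<S>" "horosphere \<gamma> \<delta> \<in> \<S>"
    "horosphere (\<gamma> + (1 + omega) ^ 0 * \<alpha>) (\<delta> + (1 + omega) ^ 0 * \<beta>) \<in> \<S>"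
    unfolding neighbour_rotate[of \<gamma> _ \<alpha> \<delta> \<beta>] by (rule linked_all_neighbours[OF assms])
  moreover have "cmod (\<gamma> * \<beta> - \<delta> * \<alpha>) = 1"
    using assms by (simp add: linked_def norm_minus_commute mult.commute)
  ultimately show ?thesis unfolding linked_def by blast
qed

text \<open>
  The new second vector is, up to a unit, a neighbour of \<open>u, v\<close>, and \<open>v\<close> becomes a neighbour of the
  new pair.
\<close>

lemma linked_add_unit:
  assumes "linked \<alpha> \<beta> \<gamma> \<delta>"
  shows "linked \<alpha> \<beta> (\<gamma> + (1 + omega) ^ k * \<alpha>) (\<delta> + (1 + omega) ^ k * \<beta>)"
proof -
  let ?z = "1 + omega"
  obtain \<S> where \<S>: "tetra_step\<^sup>*\<^sup>* tetra_start \<S>" "horosphere \<alpha> \<beta> \<in> \<S>" "horosphere \<gamma> \<delta> \<in> \<S>"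
    "horosphere (\<gamma> + ?z ^ k * \<alpha>) (\<delta> + ?z ^ k * \<beta>) \<in> \<S>"
    unfolding neighbour_rotate[of \<gamma> _ \<alpha> \<delta> \<beta>] by (rule linked_all_neighbours[OF assms])
  \<comment> \<open>The coefficient at which \<open>u\<close> cancels and the neighbour of the new pair is a unit multiple of \<open>v\<close>.\<close>
  have "?z ^ (3 + 5 * k) * ?z ^ k = ?z ^ (3 + 6 * k)"
    by (simp add: algebra_simps flip: power_add)
  then have "?z ^ (3 + 5 * k) * ?z ^ k = - 1"
    by (simp only: zeta_power_period zeta_powers)
  then have *: "?z ^ (3 + 5 * k) * (?z ^ k * x) = - x" for x
    by (simp only: mult.assoc[symmetric]) simp
  have "\<alpha> + ?z ^ (3 + 5 * k) * (\<gamma> + ?z ^ k * \<alpha>) = ?z ^ (3 + 5 * k) * \<gamma>"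
    "\<beta> + ?z ^ (3 + 5 * k) * (\<delta> + ?z ^ k * \<beta>) = ?z ^ (3 + 5 * k) * \<delta>"
    by (simp_all only: distrib_left *) simp_all
  then have "horosphere (\<alpha> + ?z ^ (3 + 5 * k) * (\<gamma> + ?z ^ k * \<alpha>))
      (\<beta> + ?z ^ (3 + 5 * k) * (\<delta> + ?z ^ k * \<beta>)) \<in> \<S>"
    using \<S>(3) horosphere_rotate[OF cmod_zeta_power] by simp
  moreover have "cmod (\<alpha> * (\<delta> + ?z ^ k * \<beta>) - \<beta> * (\<gamma> + ?z ^ k * \<alpha>)) = 1"
  proof -
    have "\<alpha> * (\<delta> + ?z ^ k * \<beta>) - \<beta> * (\<gamma> + ?z ^ k * \<alpha>) = \<alpha> * \<delta> - \<beta> * \<gamma>"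
      by (simp add: algebra_simps)
    then show ?thesis using assms by (simp add: linked_def)
  qed
  ultimately show ?thesis using \<S> unfolding linked_def by blast
qed

text \<open>
  Every Eisenstein integer is a sum of the units \<open>1, -1, \<omega>, -\<omega>\<close>.
\<close>

lemma linked_add_multiple:
  assumes "linked \<alpha> \<beta> \<gamma> \<delta>" "q \<in> eisenstein"
  shows "linked \<alpha> \<beta> (\<gamma> + q * \<alpha>) (\<delta> + q * \<beta>)"
proof -
  define good where "good q \<longleftrightarrow> (\<forall>\<gamma> \<delta>. linked \<alpha> \<beta> \<gamma> \<delta> \<longrightarrow>
    linked \<alpha> \<beta> (\<gamma> + q * \<alpha>) (\<delta> + q * \<beta>))" for q
  have add: "good (q + r)" if "good q" "good r" for q r
    using that unfolding good_def distrib_right add.assoc[symmetric] by blast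
  have multiple: "good (of_int n * e)" if e: "good e" "good (- e)" for n e
  proof (induction n rule: int_induct[where k = 0])
    case base
    then show ?case by (simp add: good_def)
  next
    case (step1 n)
    then show ?case using add[OF _ e(1), of "of_int n * e"] by (simp add: algebra_simps)
  next
    case (step2 n)
    then show ?case using add[OF _ e(2), of "of_int n * e"] by (simp add: algebra_simps)
  qed
  have unit: "good ((1 + omega) ^ k)" for k
    using linked_add_unit unfolding good_def by blast
  obtain m n where q: "q = of_int m + of_int n * omega" using assms(2) by (rule eisensteinE)
  have "good (of_int m * 1)" using unit[of 0] unit[of 3] by (intro multiple) (simp_all add: zeta_powers)
  moreover have "good (of_int n * omega)"
    using unit[of 2] unit[of 5] by (intro multiple) (simp_all add: zeta_powers)
  ultimately have "good q" using add q by simp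
  then show ?thesis using assms(1) unfolding good_def by blast
qed

text \<open>
  From \<open>x = q * y + r\<close> follows \<open>x * u + y * v = y * (v + q * u) + r * u\<close>, which has the same form with
  the smaller coefficients \<open>y, r\<close> and the linked pair \<open>v + q * u, u\<close>. The algorithm ends at \<open>x * u\<close>
  with a unit \<open>x\<close>, and this vector has the sphere of \<open>u\<close>.
\<close>

lemma coprime_combination_in_G_omega:
  assumes "x \<in> eisenstein" "y \<in> eisenstein" "eis_coprime x y" "linked \<alpha> \<beta> \<gamma> \<delta>"
  shows "horosphere (x * \<alpha> + y * \<gamma>) (x * \<beta> + y * \<delta>) \<in> G_omega"
  using assms
proof (induction arbitrary: \<alpha> \<beta> \<gamma> \<delta> rule: eisenstein_euclid_induct)
  case (zero x)
  have "eis_unit x" using zero eis_coprime_0 by blast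
  then have "horosphere (x * \<alpha>) (x * \<beta>) = horosphere \<alpha> \<beta>"
    by (intro horosphere_rotate eis_unit_cmod)
  moreover have "horosphere \<alpha> \<beta> \<in> G_omega"
    using zero(3) reachable_subset_G_omega unfolding linked_def by blast
  ultimately show ?case by simp
next
  case (step x y q)
  have "eis_coprime y (x - q * y)"
  proof -
    obtain s t where st: "s \<in> eisenstein" "t \<in> eisenstein" "s * x + t * y = 1"
      using eis_coprime_bezout step by blast
    then have "(t + s * q) * y + s * (x - q * y) = 1" by (simp add: algebra_simps)
    then show ?thesis
      using st step(3) by (intro bezout_eis_coprime[of "t + s * q" s]) (simp_all add: cmod_1_eis_unit)
  qed
  moreover have "linked (\<gamma> + q * \<alpha>) (\<delta> + q * \<beta>) \<alpha> \<beta>"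
    by (rule linked_swap[OF linked_add_multiple[OF step.prems(2) step.hyps(3)]])
  ultimately have "horosphere (y * (\<gamma> + q * \<alpha>) + (x - q * y) * \<alpha>)
      (y * (\<delta> + q * \<beta>) + (x - q * y) * \<beta>) \<in> G_omega"
    by (rule step.IH)
  then show ?case by (simp add: algebra_simps)
qed

text \<open>
  With \<open>u = (0, 1)\<close> and \<open>v = (1, 1)\<close>, the neighbour \<open>u + \<omega> * v = (\<omega>, 1 + \<omega>)\<close> is
  \<open>(1 + \<omega>) * (1 + \<omega>, 1)\<close>, the vector of the third initial sphere up to a unit.
\<close>

lemma linked_start: "linked 0 1 1 1"
proof -
  have "omega = (1 + omega) * (1 + omega)" using zeta_powers(1) by (simp add: power2_eq_square)
  then have "horosphere omega (1 + omega) = horosphere (1 + omega) 1"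
    using horosphere_rotate[OF cmod_omega(2), of "1 + omega" 1] by simp
  then have "horosphere (0 + (1 + omega) ^ 2 * 1) (1 + (1 + omega) ^ 2 * 1) \<in> tetra_start"
    by (simp add: zeta_powers tetra_start_horospheres)
  moreover have "horosphere 0 1 \<in> tetra_start" "horosphere 1 1 \<in> tetra_start"
    by (simp_all add: tetra_start_horospheres)
  ultimately show ?thesis unfolding linked_def by auto
qed

lemma P_omega_subset_G_omega: "P_omega \<subseteq> G_omega"
proof
  fix A assume "A \<in> P_omega"
  then obtain \<alpha> \<beta> where A: "A = horosphere \<alpha> \<beta>" and ab: "\<alpha> \<in> eisenstein" "\<beta> \<in> eisenstein"
    and cop: "eis_coprime \<alpha> \<beta>"
    unfolding P_omega_horosphere by blast
  have "eis_coprime (\<beta> - \<alpha>) \<alpha>"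
  proof -
    obtain s t where st: "s \<in> eisenstein" "t \<in> eisenstein" "s * \<alpha> + t * \<beta> = 1"
      using eis_coprime_bezout ab cop by blast
    then have "t * (\<beta> - \<alpha>) + (s + t) * \<alpha> = 1" by (simp add: algebra_simps)
    then show ?thesis
      using st by (intro bezout_eis_coprime[of t "s + t"]) (simp_all add: cmod_1_eis_unit)
  qed
  \<comment> \<open>\<open>(\<alpha>, \<beta>) = (\<beta> - \<alpha>) * (0, 1) + \<alpha> * (1, 1)\<close>\<close>
  from coprime_combination_in_G_omega[OF _ _ this linked_start] ab
  show "A \<in> G_omega" by (simp add: A)
qed

theorem theorem4p4:
  "B_omega \<union> {S_frac 1 0} = P_omega \<and> P_omega = G_omega"
proof
  have "eis_coprime 1 0"
    by (rule bezout_eis_coprime[of 1 0]) (simp_all add: cmod_1_eis_unit)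
  then have "S_frac 1 0 \<in> P_omega" unfolding P_omega_def by force
  then show "B_omega \<union> {S_frac 1 0} = P_omega"
    using B_omega_subset_P_omega P_omega_subset_B_omega by blast
  show "P_omega = G_omega"
    using P_omega_subset_G_omega G_omega_subset_P_omega by blast
qed

end
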